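(* Let $n\ge1$. The poset $TG_n$ is a lattice, and it is isomorphic to the weak ordering of the Coxeter group $D_n$ of even-signed permutations of $[n]$.
   Context: $[n]=\{1,\dots,n\}$. A simple graph is threshold if it has no induced subgraph isomorphic to $2K_2$ (two disjoint edges), the path with three edges on four vertices, or the 4-cycle $C_4$. A permutation $w=w_1\cdots w_n\in S_n$ is a degree ordering of a graph $([n],E)$ if $\deg_E(w_1)\ge\dots\ge\deg_E(w_n)$. $TG_n$ is the set of pairs $(w,E)$ such that $([n],E)$ is a threshold graph and $w\in S_n$ is a degree ordering of $([n],E)$. It is ordered by: $(w_1,E_1)\le(w_2,E_2)$ iff $w_1\le w_2$ in the weak ordering of $S_n$ and $E_1\subseteq E_2$. The weak ordering on $S_n$: $w\le w'$ iff $\mathrm{Inv}(w)\subseteq\mathrm{Inv}(w')$, where $\mathrm{Inv}(w)=\{(i,j):1\le i<j\le n,\ w^{-1}(i)>w^{-1}(j)\}$. A signed permutation of $[n]$ is a permutation $u$ of $\{-n,\dots,-1,1,\dots,n\}$ with $u_{-i}=-u_i$; it is even signed if the number of negative entries among $u_1,\dots,u_n$ is even; $D_n$ is the set of even-signed permutations of $[n]$. The weak ordering on $D_n$: $u\le v$ iff $\mathrm{Inv}_D(u)\subseteq\mathrm{Inv}_D(v)$, where $\mathrm{Inv}_D(u)=\{(i,j):1\le|i|\le j\le n,\ u^{-1}(i)>u^{-1}(j)\}\setminus\{(-i,i):i\in[n]\}$. *)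

theory Defs
  imports "HOL-Combinatorics.Permutations" "HOL-Algebra.Lattice"
begin

section \<open>Finite simple graphs\<close>

type_synonym 'a graph = "'a set \<times> 'a set set"

definition verts :: "'a graph \<Rightarrow> 'a set"
  where "verts G = fst G"

definition edges :: "'a graph \<Rightarrow> 'a set set"
  where "edges G = snd G"

definition simple_graph :: "'a graph \<Rightarrow> bool"
  where "simple_graph G \<longleftrightarrow> finite (verts G) \<and> (\<forall>e\<in>edges G. e \<subseteq> verts G \<and> card e = 2)"

definition induced :: "'a graph \<Rightarrow> 'a set \<Rightarrow> 'a graph"
  where "induced G W = (W, {e \<in> edges G. e \<subseteq> W})"

definition graph_isomorphic :: "'a graph \<Rightarrow> 'b graph \<Rightarrow> bool"
  where "graph_isomorphic G H \<longleftrightarrow>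
    (\<exists>f. bij_betw f (verts G) (verts H) \<and>
      (\<forall>x\<in>verts G. \<forall>y\<in>verts G. {x, y} \<in> edges G \<longleftrightarrow> {f x, f y} \<in> edges H))"

definition has_induced :: "'a graph \<Rightarrow> 'b graph \<Rightarrow> bool"
  where "has_induced G H \<longleftrightarrow> (\<exists>W\<subseteq>verts G. graph_isomorphic (induced G W) H)"

definition two_K2 :: "nat graph"
  where "two_K2 = ({1, 2, 3, 4}, {{1, 2}, {3, 4}})"

text \<open>The path with three edges on four vertices.\<close>
definition path_4 :: "nat graph"
  where "path_4 = ({1, 2, 3, 4}, {{1, 2}, {2, 3}, {3, 4}})"

definition cycle_4 :: "nat graph"
  where "cycle_4 = ({1, 2, 3, 4}, {{1, 2}, {2, 3}, {3, 4}, {4, 1}})"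

definition threshold_graph :: "'a graph \<Rightarrow> bool"
  where "threshold_graph G \<longleftrightarrow> simple_graph G \<and>
    \<not> has_induced G two_K2 \<and> \<not> has_induced G path_4 \<and> \<not> has_induced G cycle_4"

definition deg :: "'a set set \<Rightarrow> 'a \<Rightarrow> nat"
  where "deg E v = card {e \<in> E. v \<in> e}"

section \<open>Permutations and the weak ordering of \<open>S\<^sub>n\<close>\<close>

text \<open>
  A permutation \<open>w\<close> of \<open>{1..n}\<close> is a function with \<open>w permutes {1..n}\<close>; its word is
  \<open>w 1 \<dots> w n\<close>, and \<open>inv w a\<close> is the position of the letter \<open>a\<close>.
\<close>

definition Inv :: "nat \<Rightarrow> (nat \<Rightarrow> nat) \<Rightarrow> (nat \<times> nat) set"
  where "Inv n w = {(i, j). 1 \<le> i \<and> i < j \<and> j \<le> n \<and> inv w i > inv w j}"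

definition weak_le :: "nat \<Rightarrow> (nat \<Rightarrow> nat) \<Rightarrow> (nat \<Rightarrow> nat) \<Rightarrow> bool"
  where "weak_le n w w' \<longleftrightarrow> Inv n w \<subseteq> Inv n w'"

section \<open>Threshold graphs with degree orderings\<close>

definition degree_ordering :: "nat \<Rightarrow> (nat \<Rightarrow> nat) \<Rightarrow> nat set set \<Rightarrow> bool"
  where "degree_ordering n w E \<longleftrightarrow>
    w permutes {1..n} \<and> antimono_on {1..n} (\<lambda>i. deg E (w i))"

definition TG :: "nat \<Rightarrow> ((nat \<Rightarrow> nat) \<times> nat set set) set"
  where "TG n = {(w, E). threshold_graph ({1..n}, E) \<and> degree_ordering n w E}"

definition TG_poset :: "nat \<Rightarrow> ((nat \<Rightarrow> nat) \<times> nat set set) gorder"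
  where "TG_poset n = \<lparr>carrier = TG n, eq = (=),
    le = (\<lambda>(w, E) (w', E'). weak_le n w w' \<and> E \<subseteq> E')\<rparr>"

section \<open>Even-signed permutations and their weak ordering\<close>

definition signed_permutation :: "nat \<Rightarrow> (int \<Rightarrow> int) \<Rightarrow> bool"
  where "signed_permutation n u \<longleftrightarrow>
    u permutes ({- int n..int n} - {0}) \<and> (\<forall>i\<in>{1..int n}. u (- i) = - u i)"

definition even_signed_permutations :: "nat \<Rightarrow> (int \<Rightarrow> int) set"
  where "even_signed_permutations n =
    {u. signed_permutation n u \<and> even (card {i \<in> {1..int n}. u i < 0})}"

definition Inv_D :: "nat \<Rightarrow> (int \<Rightarrow> int) \<Rightarrow> (int \<times> int) set"
  where "Inv_D n u =
    {(i, j). 1 \<le> \<bar>i\<bar> \<and> \<bar>i\<bar> \<le> j \<and> j \<le> int n \<and> inv u i > inv u j} -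
    {(- i, i) | i. i \<in> {1..int n}}"

definition D_poset :: "nat \<Rightarrow> (int \<Rightarrow> int) gorder"
  where "D_poset n = \<lparr>carrier = even_signed_permutations n, eq = (=),
    le = (\<lambda>u v. Inv_D n u \<subseteq> Inv_D n v)\<rparr>"

section \<open>Isomorphism of posets\<close>

definition poset_isomorphic :: "'a gorder \<Rightarrow> 'b gorder \<Rightarrow> bool"
  where "poset_isomorphic P Q \<longleftrightarrow> partial_order P \<and> partial_order Q \<and>
    (\<exists>f. bij_betw f (carrier P) (carrier Q) \<and>
      (\<forall>x\<in>carrier P. \<forall>y\<in>carrier P. x \<sqsubseteq>\<^bsub>P\<^esub> y \<longleftrightarrow> f x \<sqsubseteq>\<^bsub>Q\<^esub> f y))"

end

theory Submission
  imports Defs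
begin

text \<open>
  Write \<open>a i\<close> for the position of \<open>i\<close> in the even-signed permutation \<open>u\<close>, so that
  \<open>a (- i) = - a i\<close>. The inversions of \<open>u\<close> record which \<open>a i < a j\<close> and which
  \<open>a i + a j < 0\<close>: the former is a permutation, the latter a threshold graph with weights
  \<open>- a i\<close>, and the permutation is a degree ordering of it. Conversely, the vertex of largest
  absolute value can be recovered from the order and the graph: if the first and the last vertex
  are adjacent, the first one is dominating, otherwise the last one is isolated. Peeling it off
  and iterating yields \<open>a\<close>, up to the sign of \<open>\<plusminus> 1\<close>, which parity fixes.
  The same peeling shows that inversion sets are exactly the biclosed sets of positive roots;
  these form a lattice under inclusion, because the closure of a union of biclosed sets is again
  biclosed and complements of biclosed sets are biclosed.
\<close>

section \<open>Posets embedded into an inclusion order\<close>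

lemma partial_order_by_inclusion:
  fixes P :: "'a gorder" and J :: "'a \<Rightarrow> 'b set"
  assumes eq: "eq P = (=)"
    and le: "\<And>x y. x \<in> carrier P \<Longrightarrow> y \<in> carrier P \<Longrightarrow> x \<sqsubseteq>\<^bsub>P\<^esub> y \<longleftrightarrow> J x \<subseteq> J y"
    and inj: "inj_on J (carrier P)"
  shows "partial_order P"
  apply unfold_locales
  subgoal by (simp only: eq)
  subgoal by (simp only: eq)
  subgoal by (simp only: eq)
  subgoal by (simp only: le)
  subgoal using le inj_onD[OF inj] by (simp add: eq)
  subgoal for x y z using le[of x y] le[of y z] le[of x z] by blast
  subgoal by (simp only: eq)
  subgoal by (simp only: eq)
  done

text \<open>Since \<open>J\<close> is an order isomorphism from \<open>P\<close> onto \<B> ordered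
  by inclusion, joins and meets found among the sets of \<B> pull back to \<open>P\<close>.\<close>

lemma lattice_by_inclusion:
  fixes P :: "'a gorder" and J :: "'a \<Rightarrow> 'b set"
  assumes eq: "eq P = (=)"
    and le: "\<And>x y. x \<in> carrier P \<Longrightarrow> y \<in> carrier P \<Longrightarrow> x \<sqsubseteq>\<^bsub>P\<^esub> y \<longleftrightarrow> J x \<subseteq> J y"
    and bij: "bij_betw J (carrier P) \<B>"
    and join: "\<And>R S. R \<in> \<B> \<Longrightarrow> S \<in> \<B> \<Longrightarrow>
      \<exists>T\<in>\<B>. R \<subseteq> T \<and> S \<subseteq> T \<and> (\<forall>X\<in>\<B>. R \<subseteq> X \<longrightarrow> S \<subseteq> X \<longrightarrow> T \<subseteq> X)"
    and meet: "\<And>R S. R \<in> \<B> \<Longrightarrow> S \<in> \<B> \<Longrightarrow>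
      \<exists>T\<in>\<B>. T \<subseteq> R \<and> T \<subseteq> S \<and> (\<forall>X\<in>\<B>. X \<subseteq> R \<longrightarrow> X \<subseteq> S \<longrightarrow> X \<subseteq> T)"
  shows "lattice P"
proof -
  interpret partial_order P
    using partial_order_by_inclusion[OF eq le] bij by (auto simp: bij_betw_def)
  have J: "J x \<in> \<B>" if "x \<in> carrier P" for x
    using bij that by (auto simp: bij_betw_def)
  have pre: "\<exists>x\<in>carrier P. J x = T" if "T \<in> \<B>" for T
    using bij that by (auto simp: bij_betw_def)
  show ?thesis
  proof unfold_locales
    fix x y assume x: "x \<in> carrier P" and y: "y \<in> carrier P"
    obtain T where T: "T \<in> \<B>" "J x \<subseteq> T" "J y \<subseteq> T" 
      "\<forall>X\<in>\<B>. J x \<subseteq> X \<longrightarrow> J y \<subseteq> X \<longrightarrow> T \<subseteq> X"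
      using join[OF J[OF x] J[OF y]] by (elim bexE conjE)
    obtain s where s: "s \<in> carrier P" "J s = T"
      using pre[OF T(1)] by blast
    have "least P s (Upper P {x, y})"
    proof (rule least_UpperI)
      show "s \<sqsubseteq>\<^bsub>P\<^esub> z" if "z \<in> Upper P {x, y}" for z
      proof -
        have "z \<in> carrier P" "x \<sqsubseteq>\<^bsub>P\<^esub> z" "y \<sqsubseteq>\<^bsub>P\<^esub> z"
          using that x y by (auto simp: Upper_def)
        then show ?thesis
          using s x y T(4) J[of z] by (simp add: le)
      qed
    qed (use s(1) x y T(2,3) in \<open>auto simp: le s(2)\<close>)
    then show "\<exists>s. least P s (Upper P {x, y})" ..
  next
    fix x y assume x: "x \<in> carrier P" and y: "y \<in> carrier P"
    obtain T where T: "T \<in> \<B>" "T \<subseteq> J x" "T \<subseteq> J y" 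
      "\<forall>X\<in>\<B>. X \<subseteq> J x \<longrightarrow> X \<subseteq> J y \<longrightarrow> X \<subseteq> T"
      using meet[OF J[OF x] J[OF y]] by (elim bexE conjE)
    obtain s where s: "s \<in> carrier P" "J s = T"
      using pre[OF T(1)] by blast
    have "greatest P s (Lower P {x, y})"
    proof (rule greatest_LowerI)
      show "z \<sqsubseteq>\<^bsub>P\<^esub> s" if "z \<in> Lower P {x, y}" for z
      proof -
        have "z \<in> carrier P" "z \<sqsubseteq>\<^bsub>P\<^esub> x" "z \<sqsubseteq>\<^bsub>P\<^esub> y"
          using that x y by (auto simp: Lower_def)
        then show ?thesis
          using s x y T(4) J[of z] by (simp add: le)
      qed
    qed (use s(1) x y T(2,3) in \<open>auto simp: le s(2)\<close>)
    then show "\<exists>s. greatest P s (Lower P {x, y})" ..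
  qed
qed

section \<open>Biclosed sets of positive roots\<close>

text \<open>
  With \<open>e (- i) = - e i\<close>, the pair \<open>(x, y)\<close> stands for the root \<open>e y - e x\<close> of type D;
  thus \<open>(x, y)\<close> and \<open>(- y, - x)\<close> stand for the same root, and \<open>(x, y)\<close> is the sum
  of \<open>(x, z)\<close> and \<open>(z, y)\<close>.
\<close>

definition pos_roots :: "nat \<Rightarrow> (int \<times> int) set"
  where "pos_roots n =
    {(x, y). x < y \<and> x \<noteq> - y \<and> x \<noteq> 0 \<and> y \<noteq> 0 \<and> \<bar>x\<bar> \<le> int n \<and> \<bar>y\<bar> \<le> int n}"

text \<open>These are the closed and co-closed sets of positive roots, stable under exchanging the
  two names of a root. The condition \<open>x \<noteq> - z\<close> excludes the sum
  \<open>2 e z\<close>, which is not a root of type D.\<close>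

definition biclosed :: "nat \<Rightarrow> (int \<times> int) set \<Rightarrow> bool"
  where "biclosed n R \<longleftrightarrow> R \<subseteq> pos_roots n \<and>
    (\<forall>x y. (x, y) \<in> R \<longrightarrow> (- y, - x) \<in> R) \<and>
    (\<forall>x y z. (x, y) \<in> R \<longrightarrow> (y, z) \<in> R \<longrightarrow> x \<noteq> - z \<longrightarrow> (x, z) \<in> R) \<and>
    (\<forall>x y z. (x, z) \<in> R \<longrightarrow> (x, y) \<in> pos_roots n \<longrightarrow> (y, z) \<in> pos_roots n \<longrightarrow>
      (x, y) \<in> R \<or> (y, z) \<in> R)"

lemma biclosed_subset: "biclosed n R \<Longrightarrow> R \<subseteq> pos_roots n"
  and biclosed_uminus: "biclosed n R \<Longrightarrow> (x, y) \<in> R \<Longrightarrow> (- y, - x) \<in> R"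
  and biclosed_trans: "biclosed n R \<Longrightarrow> (x, y) \<in> R \<Longrightarrow> (y, z) \<in> R \<Longrightarrow> x \<noteq> - z \<Longrightarrow> (x, z) \<in> R"
  and biclosed_split: "biclosed n R \<Longrightarrow> (x, z) \<in> R \<Longrightarrow>
    (x, y) \<in> pos_roots n \<Longrightarrow> (y, z) \<in> pos_roots n \<Longrightarrow> (x, y) \<in> R \<or> (y, z) \<in> R"
  unfolding biclosed_def by blast+

lemma pos_roots_uminus: "(x, y) \<in> pos_roots n \<Longrightarrow> (- y, - x) \<in> pos_roots n"
  by (auto simp: pos_roots_def)

lemma pos_roots_trans:
  "(x, y) \<in> pos_roots n \<Longrightarrow> (y, z) \<in> pos_roots n \<Longrightarrow> x \<noteq> - z \<Longrightarrow> (x, z) \<in> pos_roots n"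
  by (auto simp: pos_roots_def)

text \<open>Complementation exchanges closure under sums with the splitting property, so meets
  reduce to joins.\<close>

lemma biclosed_complement:
  assumes "biclosed n R"
  shows "biclosed n (pos_roots n - R)"
  unfolding biclosed_def
proof (intro conjI allI impI)
  fix x y assume "(x, y) \<in> pos_roots n - R"
  then show "(- y, - x) \<in> pos_roots n - R"
    using pos_roots_uminus biclosed_uminus[OF assms, of "- y" "- x"] by auto
next
  fix x y z assume "(x, y) \<in> pos_roots n - R" "(y, z) \<in> pos_roots n - R" "x \<noteq> - z"
  then show "(x, z) \<in> pos_roots n - R"
    using pos_roots_trans biclosed_split[OF assms] by blast
next
  fix x y z assume "(x, z) \<in> pos_roots n - R" "(x, y) \<in> pos_roots n" "(y, z) \<in> pos_roots n"
  then show "(x, y) \<in> pos_roots n - R \<or> (y, z) \<in> pos_roots n - R"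
    using biclosed_trans[OF assms, of x y z] by (auto simp: pos_roots_def)
qed blast

section \<open>Joins and meets of biclosed sets\<close>

inductive_set root_closure :: "(int \<times> int) set \<Rightarrow> (int \<times> int) set" for R
  where
    base: "(x, y) \<in> R \<Longrightarrow> (x, y) \<in> root_closure R"
  | sum: "(x, y) \<in> root_closure R \<Longrightarrow> (y, z) \<in> root_closure R \<Longrightarrow> x \<noteq> - z \<Longrightarrow>
      (x, z) \<in> root_closure R"

lemma root_closure_uminus:
  assumes "(x, y) \<in> root_closure R" and "\<And>x y. (x, y) \<in> R \<Longrightarrow> (- y, - x) \<in> R"
  shows "(- y, - x) \<in> root_closure R"
  using assms(1)
proof induction
  case (sum x y z)
  then show ?case
    using root_closure.sum[of "- z" "- y" R "- x"] by auto
qed (auto intro: assms(2) root_closure.base)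

lemma root_closure_pos:
  assumes "(x, y) \<in> root_closure R" and "R \<subseteq> pos_roots n"
  shows "(x, y) \<in> pos_roots n"
  using assms(1)
  by induction (use assms(2) pos_roots_trans in blast)+

text \<open>
  If the root \<open>(x, y)\<close> of the closure has the decompositions \<open>(x, z) + (z, y)\<close> and
  \<open>(x, t) + (t, y)\<close>, and the second one comes from the closure, then a summand of one
  decomposition minus a summand of the other is a root, and the induction hypothesis splits
  the larger of the two along it.
\<close>

lemma root_closure_split:
  assumes "(x, y) \<in> root_closure R" and sub: "R \<subseteq> pos_roots n"
    and um: "\<And>x y. (x, y) \<in> R \<Longrightarrow> (- y, - x) \<in> R"
    and split: "\<And>x y z. (x, y) \<in> R \<Longrightarrow> (x, z) \<in> pos_roots n \<Longrightarrow> (z, y) \<in> pos_roots n \<Longrightarrow>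
      (x, z) \<in> R \<or> (z, y) \<in> R"
    and "(x, z) \<in> pos_roots n" and "(z, y) \<in> pos_roots n"
  shows "(x, z) \<in> root_closure R \<or> (z, y) \<in> root_closure R"
  using assms(1,5,6)
proof (induction arbitrary: z)
  case (base x y)
  then show ?case
    using split root_closure.base by blast
next
  case (sum x t y)
  note um' = root_closure_uminus[OF _ um]
  have xt: "(x, t) \<in> pos_roots n" and ty: "(t, y) \<in> pos_roots n"
    using sum.hyps root_closure_pos[OF _ sub] by blast+
  have lt: "x < t" "t < y" "x < z" "z < y"
    using xt ty sum.prems by (auto simp: pos_roots_def)
  have range: "c \<noteq> 0 \<and> \<bar>c\<bar> \<le> int n" if "c \<in> {x, y, z, t, - x, - y}" for c
    using that xt ty sum.prems unfolding pos_roots_def by fastforce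
  have mem: "(a, b) \<in> pos_roots n"
    if "a < b" "a \<noteq> - b" "a \<in> {x, y, z, t, - x, - y}" "b \<in> {x, y, z, t, - x, - y}" for a b
    using that(1,2) range[OF that(3)] range[OF that(4)] by (simp add: pos_roots_def)
  have ne: "x \<noteq> - z" "z \<noteq> - y" "x \<noteq> - t" "t \<noteq> - y"
    using xt ty sum.prems by (auto simp: pos_roots_def)
  consider "z = t" | "z < t" "z \<noteq> - t" | "t < z" "t \<noteq> - z" | "z = - t" "x < - y" | "z = - t" "- y < x"
    using \<open>x \<noteq> - y\<close> by linarith
  then show ?case
  proof cases
    case 1
    then show ?thesis using sum.hyps by blast
  next
    \<comment> \<open>Here \<open>(z, t)\<close> is a root, so \<open>(x, t)\<close> splits along
      it; a summand \<open>(z, t)\<close> in the closure extends by \<open>(t, y)\<close> to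
      \<open>(z, y)\<close>. Case 3 is the mirror image.\<close>
    case 2
    then have "(x, z) \<in> root_closure R \<or> (z, t) \<in> root_closure R"
      using lt ne by (intro sum.IH(1) mem) auto
    then show ?thesis
      using root_closure.sum[OF _ sum.hyps(2) ne(2)] by blast
  next
    case 3
    then have "(t, z) \<in> root_closure R \<or> (z, y) \<in> root_closure R"
      using lt ne by (intro sum.IH(2) mem) auto
    then show ?thesis
      using root_closure.sum[OF sum.hyps(1) _ ne(1)] by blast
  next
    \<comment> \<open>When \<open>z = - t\<close>, no root joins \<open>z\<close> and
      \<open>t\<close>. Under their other names, however, \<open>(x, z)\<close> is
      \<open>(t, - x)\<close> and \<open>(z, y)\<close> is \<open>(- y, t)\<close>, so the cut is
      made at \<open>- y\<close> in \<open>(x, t)\<close>, or in case 5 at \<open>- x\<close> in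
      \<open>(t, y)\<close>.\<close>
    case 4
    then have "(x, - y) \<in> root_closure R \<or> (- y, t) \<in> root_closure R"
      using lt ne \<open>x \<noteq> - y\<close> by (intro sum.IH(1) mem) auto
    then show ?thesis
    proof
      assume "(x, - y) \<in> root_closure R"
      then have "(y, - x) \<in> root_closure R"
        using um'[of x "- y"] by simp
      then have "(t, - x) \<in> root_closure R"
        using root_closure.sum[OF sum.hyps(2)] lt by simp
      then show ?thesis
        using um'[of t "- x"] 4 by simp
    next
      assume "(- y, t) \<in> root_closure R"
      then show ?thesis
        using um'[of "- y" t] 4 by simp
    qed
  next
    case 5
    then have "(t, - x) \<in> root_closure R \<or> (- x, y) \<in> root_closure R"
      using lt ne \<open>x \<noteq> - y\<close> by (intro sum.IH(2) mem) auto
    then show ?thesis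
    proof
      assume "(t, - x) \<in> root_closure R"
      then show ?thesis
        using um'[of t "- x"] 5 by simp
    next
      assume "(- x, y) \<in> root_closure R"
      then have "(- y, x) \<in> root_closure R"
        using um'[of "- x" y] by simp
      then have "(- y, t) \<in> root_closure R"
        using root_closure.sum[OF _ sum.hyps(1)] lt by simp
      then show ?thesis
        using um'[of "- y" t] 5 by simp
    qed
  qed
qed

text \<open>The splitting property passes to unions, and by \<open>root_closure_split\<close> from a
  set to its closure; closedness holds by construction.\<close>

lemma biclosed_root_closure_Un:
  assumes R: "biclosed n R" and S: "biclosed n S"
  shows "biclosed n (root_closure (R \<union> S))"
proof -
  have sub: "R \<union> S \<subseteq> pos_roots n"
    using R S biclosed_subset by blast
  have um: "(- y, - x) \<in> R \<union> S" if "(x, y) \<in> R \<union> S" for x y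
    using that biclosed_uminus R S by blast
  have split: "(x, z) \<in> R \<union> S \<or> (z, y) \<in> R \<union> S"
    if "(x, y) \<in> R \<union> S" "(x, z) \<in> pos_roots n" "(z, y) \<in> pos_roots n" for x y z
    using that biclosed_split R S by blast
  show ?thesis
    unfolding biclosed_def
  proof (intro conjI allI impI)
    show "root_closure (R \<union> S) \<subseteq> pos_roots n"
      using root_closure_pos[OF _ sub] by auto
  next
    fix x y assume "(x, y) \<in> root_closure (R \<union> S)"
    then show "(- y, - x) \<in> root_closure (R \<union> S)"
      by (rule root_closure_uminus[OF _ um])
  next
    fix x y z assume "(x, z) \<in> root_closure (R \<union> S)" "(x, y) \<in> pos_roots n" "(y, z) \<in> pos_roots n"
    then show "(x, y) \<in> root_closure (R \<union> S) \<or> (y, z) \<in> root_closure (R \<union> S)"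
      using root_closure_split[OF _ sub um split] by simp
  qed (rule root_closure.sum)
qed

lemma root_closure_least:
  assumes "biclosed n X" and "R \<subseteq> X"
  shows "root_closure R \<subseteq> X"
proof -
  have "(x, y) \<in> X" if "(x, y) \<in> root_closure R" for x y
    using that by induction (use assms biclosed_trans in blast)+
  then show ?thesis by auto
qed

lemma biclosed_join:
  assumes "biclosed n R" and "biclosed n S"
  shows "\<exists>T. biclosed n T \<and> R \<subseteq> T \<and> S \<subseteq> T \<and> (\<forall>X. biclosed n X \<longrightarrow> R \<subseteq> X \<longrightarrow> S \<subseteq> X \<longrightarrow> T \<subseteq> X)"
  using biclosed_root_closure_Un[OF assms] root_closure.base[of _ _ "R \<union> S"]
    root_closure_least[of n _ "R \<union> S"]
  by (intro exI[of _ "root_closure (R \<union> S)"]) auto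

text \<open>By De Morgan, the meet is the complement of the join of the complements.\<close>

lemma biclosed_meet:
  assumes "biclosed n R" and "biclosed n S"
  shows "\<exists>T. biclosed n T \<and> T \<subseteq> R \<and> T \<subseteq> S \<and> (\<forall>X. biclosed n X \<longrightarrow> X \<subseteq> R \<longrightarrow> X \<subseteq> S \<longrightarrow> X \<subseteq> T)"
proof -
  let ?c = "\<lambda>R. pos_roots n - R"
  obtain T where T: "biclosed n T" "?c R \<subseteq> T" "?c S \<subseteq> T"
    "\<And>X. biclosed n X \<Longrightarrow> ?c R \<subseteq> X \<Longrightarrow> ?c S \<subseteq> X \<Longrightarrow> T \<subseteq> X"
    using biclosed_join assms[THEN biclosed_complement] by metis
  have "X \<subseteq> ?c T" if "biclosed n X" "X \<subseteq> R" "X \<subseteq> S" for X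
    using T(4)[of "?c X"] that biclosed_complement[of n X] biclosed_subset[of n X] by blast
  moreover have "?c T \<subseteq> R" "?c T \<subseteq> S"
    using T(2,3) by auto
  ultimately show ?thesis
    using biclosed_complement[OF T(1)] by blast
qed

section \<open>Realizing a compatible order and graph by a valuation\<close>

text \<open>
  The vertex of largest absolute value is the minimum of the order if the minimum and the
  maximum are adjacent, and the maximum otherwise. The sign of the vertex that remains at the
  end is not constrained and takes care of the parity.
\<close>

lemma realizing_valuation:
  fixes V :: "'a set" and L E :: "'a \<Rightarrow> 'a \<Rightarrow> bool"
  assumes "finite V" and "V \<noteq> {}"
    and "\<And>x. x \<in> V \<Longrightarrow> \<not> L x x"
    and "\<And>x y z. x \<in> V \<Longrightarrow> y \<in> V \<Longrightarrow> z \<in> V \<Longrightarrow> L x y \<Longrightarrow> L y z \<Longrightarrow> L x z"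
    and "\<And>x y. x \<in> V \<Longrightarrow> y \<in> V \<Longrightarrow> x \<noteq> y \<Longrightarrow> L x y \<or> L y x"
    and "\<And>x y. x \<in> V \<Longrightarrow> y \<in> V \<Longrightarrow> E x y \<Longrightarrow> E y x"
    and "\<And>x y z. x \<in> V \<Longrightarrow> y \<in> V \<Longrightarrow> z \<in> V \<Longrightarrow> L x y \<Longrightarrow> E y z \<Longrightarrow> z \<noteq> x \<Longrightarrow> z \<noteq> y \<Longrightarrow> E x z"
  shows "\<exists>a :: 'a \<Rightarrow> int. bij_betw (\<lambda>x. \<bar>a x\<bar>) V {1..int (card V)} \<and>
    (\<forall>x\<in>V. \<forall>y\<in>V. L x y \<longrightarrow> a x < a y) \<and>
    (\<forall>x\<in>V. \<forall>y\<in>V. x \<noteq> y \<longrightarrow> (E x y \<longleftrightarrow> a x + a y < 0)) \<and>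
    (even (card {x \<in> V. a x < 0}) \<longleftrightarrow> p)"
  using assms
proof (induction "card V" arbitrary: V p rule: less_induct)
  case less
  note fin = \<open>finite V\<close> and irr = less.prems(3) and tr = less.prems(4) and tot = less.prems(5)
    and sym = less.prems(6) and compat = less.prems(7)
  show ?case
  proof (cases "card V = 1")
    case True
    then obtain v where V: "V = {v}"
      by (auto simp: card_1_singleton_iff)
    have [simp]: "{x. x = v \<and> P} = (if P then {v} else {})" for P
      by auto
    \<comment> \<open>The sign of the only value is free: 1 gives an even and -1 an odd number of
      negative values, so either parity \<open>p\<close> is attained.\<close>
    show ?thesis
      by (rule exI[of _ "\<lambda>_. if p then 1 else - 1"]) (use irr in \<open>auto simp: V bij_betw_def\<close>)
  next
    case False
    then have card: "1 < card V"
      using fin \<open>V \<noteq> {}\<close> by (metis One_nat_def Suc_lessI card_gt_0_iff)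
    have L: "transp_on V L" "totalp_on V L"
      by (auto intro!: transp_onI totalp_onI intro: tr dest: tot)
    obtain m where m: "m \<in> V" "\<And>x. x \<in> V \<Longrightarrow> x \<noteq> m \<Longrightarrow> L m x"
      using Finite_Set.bex_least_element[OF fin \<open>V \<noteq> {}\<close> L] by (elim bexE) simp
    obtain M where M: "M \<in> V" "\<And>x. x \<in> V \<Longrightarrow> x \<noteq> M \<Longrightarrow> L x M"
      using Finite_Set.bex_greatest_element[OF fin \<open>V \<noteq> {}\<close> L] by (elim bexE) simp
    have "m \<noteq> M"
    proof
      assume "m = M"
      have "V \<subseteq> {m}"
      proof
        fix x assume x: "x \<in> V"
        then show "x \<in> {m}"
          using m(2)[OF x] M(2)[OF x] irr[OF x] tr[OF x m(1) x] \<open>m = M\<close> by auto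
      qed
      then show False
        using card card_mono[of "{m}" V] by simp
    qed
    define v where "v = (if E m M then m else M)"
    have v: "v \<in> V"
      using m M by (simp add: v_def)
    \<comment> \<open>If \<open>m\<close> and \<open>M\<close> are adjacent, every \<open>x\<close>
      below \<open>M\<close> inherits the neighbour \<open>m\<close>, so \<open>m\<close> is
      dominating. If not, \<open>M\<close> is isolated, because an edge from \<open>x\<close> to
      \<open>M\<close> would be inherited by \<open>m\<close>.\<close>
    have E_v: "E v x \<longleftrightarrow> E m M" "E x v \<longleftrightarrow> E m M" if x: "x \<in> V" "x \<noteq> v" for x
    proof -
      have "E m x" if "E m M" "x \<noteq> m"
        using that x m(1) M sym[of m M] sym[of x m] compat[of x M m] \<open>m \<noteq> M\<close> by (cases "x = M") auto
      moreover have "E m M" if "E x M" "x \<noteq> M"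
        using that x m M(1) compat[of m x M] \<open>m \<noteq> M\<close> by (cases "x = m") auto
      ultimately have 1: "E v x \<longleftrightarrow> E m M"
        using x sym[of M x] m M by (cases "E m M") (auto simp: v_def)
      have 2: "E x v \<longleftrightarrow> E v x"
        using x(1) v sym[of x v] sym[of v x] by blast
      show "E v x \<longleftrightarrow> E m M" "E x v \<longleftrightarrow> E m M"
        using 1 2 by simp_all
    qed
    \<comment> \<open>The absolute value \<open>card V\<close> exceeds all others, so the sign of
      \<open>s\<close> decides both the place of \<open>v\<close> in the order and every sum with
      \<open>s\<close>: negative for a dominating first vertex, positive for an isolated last
      one.\<close>
    define s :: int where "s = (if E m M then - int (card V) else int (card V))"
    let ?W = "V - {v}"
    have card_W: "card ?W = card V - 1" "card ?W < card V" "?W \<noteq> {}" "finite ?W"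
    proof -
      show 1: "card ?W = card V - 1" "finite ?W"
        using fin v by simp_all
      then show "card ?W < card V"
        using card by simp
      show "?W \<noteq> {}"
        using 1 card by (metis card.empty zero_less_diff less_irrefl)
    qed
    \<comment> \<open>If \<open>E m M\<close> holds, \<open>v\<close> contributes one negative
      value, so the rest must have the opposite parity.\<close>
    obtain a :: "'a \<Rightarrow> int" where a: "bij_betw (\<lambda>x. \<bar>a x\<bar>) ?W {1..int (card ?W)}"
        "\<forall>x\<in>?W. \<forall>y\<in>?W. L x y \<longrightarrow> a x < a y"
        "\<forall>x\<in>?W. \<forall>y\<in>?W. x \<noteq> y \<longrightarrow> (E x y \<longleftrightarrow> a x + a y < 0)"
        "even (card {x \<in> ?W. a x < 0}) \<longleftrightarrow> (p \<noteq> E m M)"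
    proof -
      have "\<exists>a :: 'a \<Rightarrow> int. bij_betw (\<lambda>x. \<bar>a x\<bar>) ?W {1..int (card ?W)} \<and>
          (\<forall>x\<in>?W. \<forall>y\<in>?W. L x y \<longrightarrow> a x < a y) \<and>
          (\<forall>x\<in>?W. \<forall>y\<in>?W. x \<noteq> y \<longrightarrow> (E x y \<longleftrightarrow> a x + a y < 0)) \<and>
          (even (card {x \<in> ?W. a x < 0}) \<longleftrightarrow> (p \<noteq> E m M))"
        by (rule less.hyps[OF card_W(2,4,3)]) (use irr tr tot sym compat in \<open>blast+\<close>)
      then show ?thesis
        using that by (elim exE conjE)
    qed
    have a_less: "\<bar>a x\<bar> < int (card V)" if "x \<in> ?W" for x
      using bij_betwE[OF a(1)] that card_W card by force
    define b where "b = a(v := s)"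
    have b: "b v = s" "\<And>x. x \<in> ?W \<Longrightarrow> b x = a x"
      by (auto simp: b_def)
    have "\<bar>s\<bar> = int (card V)"
      by (simp add: s_def)
    have "bij_betw (\<lambda>x. \<bar>b x\<bar>) ?W {1..int (card ?W)}"
      using a(1) by (rule bij_betw_cong[THEN iffD1, rotated]) (simp add: b)
    moreover have "int (card ?W) = int (card V) - 1"
      using card_W card by simp
    ultimately have "bij_betw (\<lambda>x. \<bar>b x\<bar>) (insert v ?W) (insert (int (card V)) {1..int (card V) - 1})"
      using b(1) \<open>\<bar>s\<bar> = int (card V)\<close> notIn_Un_bij_betw[of v ?W "\<lambda>x. \<bar>b x\<bar>" "{1..int (card V) - 1}"]
      by simp
    moreover have "insert v ?W = V" "insert (int (card V)) {1..int (card V) - 1} = {1..int (card V)}"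
      using v card by auto
    ultimately have 1: "bij_betw (\<lambda>x. \<bar>b x\<bar>) V {1..int (card V)}"
      by simp
    have asym: "\<not> L y x" if "x \<in> V" "y \<in> V" "L x y" for x y
      using that irr tr by blast
    have 2: "b x < b y" if xy: "x \<in> V" "y \<in> V" "L x y" for x y
    proof -
      consider "x \<in> ?W" "y \<in> ?W" | "x = v" "y \<in> ?W" | "x \<in> ?W" "y = v"
        using xy irr[OF v] by blast
      then show ?thesis
      proof cases
        case 1
        then show ?thesis using a(2) xy b by simp
      next
        case 2
        then have "E m M"
          using xy M(2)[of y] asym[of x y] by (cases "E m M") (simp_all add: v_def)
        then show ?thesis using a_less[of y] 2 b by (simp add: s_def)
      next
        case 3
        then have "\<not> E m M"
          using xy m(2)[of x] asym[of x y] by (cases "E m M") (simp_all add: v_def)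
        then show ?thesis using a_less[of x] 3 b by (simp add: s_def)
      qed
    qed
    have 3: "E x y \<longleftrightarrow> b x + b y < 0" if xy: "x \<in> V" "y \<in> V" "x \<noteq> y" for x y
    proof -
      consider "x \<in> ?W" "y \<in> ?W" | "x = v" "y \<in> ?W" | "x \<in> ?W" "y = v"
        using xy by blast
      then show ?thesis
      proof cases
        case 1
        then show ?thesis using a(3) xy b by simp
      next
        case 2
        then show ?thesis using E_v[of y] a_less[of y] b by (auto simp: s_def)
      next
        case 3
        then show ?thesis using E_v[of x] a_less[of x] b by (auto simp: s_def)
      qed
    qed
    have "{x \<in> V. b x < 0} = (if E m M then insert v {x \<in> ?W. a x < 0} else {x \<in> ?W. a x < 0})"
      using v card by (auto simp: b_def s_def)
    then have 4: "even (card {x \<in> V. b x < 0}) \<longleftrightarrow> p"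
      using a(4) fin by (auto simp: card_insert_if)
    show ?thesis
      using 1 2 3 4 by blast
  qed
qed

section \<open>Signed permutations\<close>

text \<open>Oddness is demanded only on \<open>{1..int n}\<close>. It holds everywhere because off
  its domain, in particular at 0, a permutation is the identity.\<close>

lemma signed_permutation_uminus:
  assumes "signed_permutation n u"
  shows "u (- x) = - u x"
proof -
  have u: "u permutes ({- int n..int n} - {0})" "\<And>i. i \<in> {1..int n} \<Longrightarrow> u (- i) = - u i"
    using assms by (auto simp: signed_permutation_def)
  consider "x \<in> {1..int n}" | "- x \<in> {1..int n}"
    | "x \<notin> {- int n..int n} - {0}" "- x \<notin> {- int n..int n} - {0}"
    by force
  then show ?thesis
    using u(2)[of x] u(2)[of "- x"] by cases (simp_all add: permutes_not_in[OF u(1)])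
qed

lemma signed_permutation_inv:
  assumes "signed_permutation n u"
  shows "signed_permutation n (inv u)"
proof -
  have u: "u permutes ({- int n..int n} - {0})"
    using assms by (simp add: signed_permutation_def)
  have "inv u (- i) = - inv u i" for i
    using signed_permutation_uminus[OF assms, of "inv u i"] permutes_inverses[OF u] by metis
  then show ?thesis
    using permutes_inv[OF u] by (simp add: signed_permutation_def)
qed

lemma signed_permutation_range:
  assumes "signed_permutation n u"
  shows "u x \<in> {- int n..int n} - {0} \<longleftrightarrow> x \<in> {- int n..int n} - {0}"
  using assms permutes_in_image unfolding signed_permutation_def by metis

lemma signed_permutation_inj:
  assumes "signed_permutation n u"
  shows "u x = u y \<longleftrightarrow> x = y"
  using assms permutes_inj unfolding signed_permutation_def by (metis injD)

lemma signed_permutation_inv_inv: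
  assumes "signed_permutation n u"
  shows "inv (inv u) = u"
  using assms permutes_inv_inv unfolding signed_permutation_def by blast

text \<open>If \<open>i\<close> is positive and \<open>inv u i\<close> negative, then
  \<open>- inv u i\<close> is a positive index at which \<open>u\<close> takes the value
  \<open>- i\<close>. This correspondence is bijective, so inversion preserves
  even-signedness.\<close>

lemma card_negative_inv:
  assumes "signed_permutation n u"
  shows "card {i \<in> {1..int n}. inv u i < 0} = card {i \<in> {1..int n}. u i < 0}"
proof -
  have u: "u permutes ({- int n..int n} - {0})"
    using assms by (simp add: signed_permutation_def)
  note um = signed_permutation_uminus[OF assms] signed_permutation_uminus[OF signed_permutation_inv[OF assms]]
  have 1: "- inv u i \<in> {i \<in> {1..int n}. u i < 0}" if "i \<in> {i \<in> {1..int n}. inv u i < 0}" for i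
    using that signed_permutation_range[OF signed_permutation_inv[OF assms], of i]
    by (auto simp: um permutes_inverses[OF u])
  have 2: "- u i \<in> {i \<in> {1..int n}. inv u i < 0}" if "i \<in> {i \<in> {1..int n}. u i < 0}" for i
    using that signed_permutation_range[OF assms, of i]
    by (auto simp: um permutes_inverses[OF u])
  have "bij_betw (\<lambda>i. - inv u i) {i \<in> {1..int n}. inv u i < 0} {i \<in> {1..int n}. u i < 0}"
    by (rule bij_betw_byWitness[where f' = "\<lambda>i. - u i"])
      (use 1 2 in \<open>auto simp only: um permutes_inverses[OF u] minus_minus image_subset_iff\<close>)
  then show ?thesis
    by (rule bij_betw_same_card)
qed

lemma even_signed_inv_iff:
  "inv u \<in> even_signed_permutations n \<longleftrightarrow> u \<in> even_signed_permutations n"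
  if "signed_permutation n u"
  using that signed_permutation_inv[OF that] card_negative_inv[OF that]
  by (simp add: even_signed_permutations_def)

section \<open>Inversion sets of signed permutations as sets of roots\<close>

text \<open>An inverted root enters under both of its names, as \<open>biclosed\<close> demands,
  whereas \<open>Inv_D\<close> keeps only the name with positive sum.\<close>

definition D_roots :: "nat \<Rightarrow> (int \<Rightarrow> int) \<Rightarrow> (int \<times> int) set"
  where "D_roots n u = {(x, y) \<in> pos_roots n. inv u y < inv u x}"

lemma Inv_D_iff: "(x, y) \<in> Inv_D n u \<longleftrightarrow> (x, y) \<in> D_roots n u \<and> 0 < x + y"
  by (cases "x = y") (auto simp: Inv_D_def D_roots_def pos_roots_def)

lemma D_roots_uminus:
  assumes "signed_permutation n u"
  shows "(- y, - x) \<in> D_roots n u \<longleftrightarrow> (x, y) \<in> D_roots n u"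
  using signed_permutation_uminus[OF signed_permutation_inv[OF assms]]
  by (auto simp: D_roots_def pos_roots_def)

text \<open>Of the two names \<open>(x, y)\<close> and \<open>(- y, - x)\<close> of a root exactly
  one has positive sum, so \<open>Inv_D\<close> and \<open>D_roots\<close> carry the same
  information.\<close>

lemma Inv_D_subset_iff:
  assumes "signed_permutation n u" and "signed_permutation n v"
  shows "Inv_D n u \<subseteq> Inv_D n v \<longleftrightarrow> D_roots n u \<subseteq> D_roots n v"
proof
  assume sub: "Inv_D n u \<subseteq> Inv_D n v"
  have "(x, y) \<in> D_roots n v" if "(x, y) \<in> D_roots n u" for x y
  proof -
    consider "0 < x + y" | "0 < - y + - x"
      using \<open>(x, y) \<in> D_roots n u\<close> by (force simp: D_roots_def pos_roots_def)
    then show ?thesis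
    proof cases
      case 1
      then show ?thesis
        using sub that Inv_D_iff by blast
    next
      case 2
      then show ?thesis
        using sub that Inv_D_iff D_roots_uminus[OF assms(1)] D_roots_uminus[OF assms(2)] by blast
    qed
  qed
  then show "D_roots n u \<subseteq> D_roots n v"
    by auto
next
  assume "D_roots n u \<subseteq> D_roots n v"
  then show "Inv_D n u \<subseteq> Inv_D n v"
    using Inv_D_iff by auto
qed

text \<open>Closedness is transitivity of the order of positions, and the splitting property is its
  linearity.\<close>

lemma biclosed_D_roots:
  assumes "signed_permutation n u"
  shows "biclosed n (D_roots n u)"
  unfolding biclosed_def
proof (intro conjI allI impI)
  fix x y assume "(x, y) \<in> D_roots n u"
  then show "(- y, - x) \<in> D_roots n u"
    using D_roots_uminus[OF assms] by blast
qed (auto simp: D_roots_def intro: pos_roots_trans)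

text \<open>
  Counting the smaller elements different from \<open>\<plusminus> k\<close> determines \<open>k\<close> up to the sign of \<open>\<plusminus> 1\<close>.
\<close>

lemma card_smaller_signed:
  assumes "k \<in> {- int n..int n} - {0}"
  shows "int (card {y \<in> {- int n..int n} - {0}. y \<noteq> k \<and> y \<noteq> - k \<and> y < k}) =
    (if 0 < k then int n + k - 2 else int n + k)"
proof (cases "0 < k")
  case True
  have "{y \<in> {- int n..int n} - {0}. y \<noteq> k \<and> y \<noteq> - k \<and> y < k} = {- int n..k - 1} - {0, - k}"
    using True assms by auto
  moreover have "card ({- int n..k - 1} - {0, - k}) = card {- int n..k - 1} - card {0, - k}"
    using True assms by (intro card_Diff_subset) auto
  ultimately show ?thesis
    using True assms by simp
next
  case False
  have "{y \<in> {- int n..int n} - {0}. y \<noteq> k \<and> y \<noteq> - k \<and> y < k} = {- int n..k - 1}"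
    using False assms by auto
  then show ?thesis
    using False assms by simp
qed

text \<open>The roots determine how the positions of \<open>x\<close> and \<open>y\<close> compare
  unless \<open>y = - x\<close>. Counting smaller positions then leaves only the sign of a position
  of absolute value 1 open, and reversing that sign would change the parity.\<close>

lemma inj_on_D_roots: "inj_on (D_roots n) (even_signed_permutations n)"
proof (rule inj_onI)
  fix u v assume u: "u \<in> even_signed_permutations n" and v: "v \<in> even_signed_permutations n"
    and eq: "D_roots n u = D_roots n v"
  let ?V = "{- int n..int n} - {0}"
  define b where "b = inv u"
  define c where "c = inv v"
  have su: "signed_permutation n u" and sv: "signed_permutation n v"
    using u v by (auto simp: even_signed_permutations_def)
  have b: "signed_permutation n b" and c: "signed_permutation n c"
    using signed_permutation_inv[OF su] signed_permutation_inv[OF sv] by (simp_all add: b_def c_def)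
  have par: "even (card {i \<in> {1..int n}. b i < 0})" "even (card {i \<in> {1..int n}. c i < 0})"
    using u v card_negative_inv[OF su] card_negative_inv[OF sv]
    by (auto simp: even_signed_permutations_def b_def c_def)
  have less_iff: "b x < b y \<longleftrightarrow> c x < c y" if "x \<in> ?V" "y \<in> ?V" "x \<noteq> - y" for x y
  proof -
    have *: "b y < b x \<longleftrightarrow> c y < c x" if "x < y" "x \<in> ?V" "y \<in> ?V" "x \<noteq> - y" for x y
    proof -
      have "(x, y) \<in> pos_roots n"
        using that by (auto simp: pos_roots_def)
      then show ?thesis
        using eq by (auto simp: D_roots_def b_def c_def set_eq_iff)
    qed
    show ?thesis
    proof (cases x y rule: linorder_cases)
      case less
      then show ?thesis
        using *[of x y] that signed_permutation_inj[OF b, of x y] signed_permutation_inj[OF c, of x y]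
        by linarith
    next
      case greater
      then show ?thesis
        using *[of y x] that by auto
    qed simp
  qed
  \<comment> \<open>The element \<open>- x\<close> is left out of the count because no root compares
    it with \<open>x\<close>.\<close>
  define K where "K a x = card {y \<in> ?V. y \<noteq> x \<and> y \<noteq> - x \<and> a y < a x}" for a :: "int \<Rightarrow> int" and x
  have K: "int (K a x) = (if 0 < a x then int n + a x - 2 else int n + a x)"
    if a: "signed_permutation n a" and x: "x \<in> ?V" for a x
  proof -
    have per: "a permutes ?V"
      using a by (simp add: signed_permutation_def)
    have "a ` {y \<in> ?V. y \<noteq> x \<and> y \<noteq> - x \<and> a y < a x} = {z \<in> ?V. z \<noteq> a x \<and> z \<noteq> - a x \<and> z < a x}"
    proof (intro equalityI subsetI)
      fix z assume "z \<in> {z \<in> ?V. z \<noteq> a x \<and> z \<noteq> - a x \<and> z < a x}"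
      moreover from this obtain y where "y \<in> ?V" "z = a y"
        using permutes_image[OF per] by blast
      ultimately show "z \<in> a ` {y \<in> ?V. y \<noteq> x \<and> y \<noteq> - x \<and> a y < a x}"
        using signed_permutation_uminus[OF a] by auto
    next
      fix z assume "z \<in> a ` {y \<in> ?V. y \<noteq> x \<and> y \<noteq> - x \<and> a y < a x}"
      then obtain y where y: "z = a y" "y \<in> ?V" "y \<noteq> x" "y \<noteq> - x" "a y < a x"
        by blast
      moreover have "a y \<noteq> - a x"
        using y signed_permutation_inj[OF a, of y "- x"] signed_permutation_uminus[OF a, of x] by simp
      ultimately show "z \<in> {z \<in> ?V. z \<noteq> a x \<and> z \<noteq> - a x \<and> z < a x}"
        using signed_permutation_range[OF a, of y] by simp
    qed
    moreover have "card (a ` {y \<in> ?V. y \<noteq> x \<and> y \<noteq> - x \<and> a y < a x}) = K a x"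
      unfolding K_def by (rule card_image[OF permutes_inj_on[OF per]])
    ultimately have "K a x = card {z \<in> ?V. z \<noteq> a x \<and> z \<noteq> - a x \<and> z < a x}"
      by simp
    then show ?thesis
      using card_smaller_signed[of "a x" n] signed_permutation_range[OF a, of x] x by simp
  qed
  have K_eq: "K b x = K c x" if "x \<in> ?V" for x
  proof -
    have "y \<in> ?V \<and> y \<noteq> x \<and> y \<noteq> - x \<and> b y < b x \<longleftrightarrow> y \<in> ?V \<and> y \<noteq> x \<and> y \<noteq> - x \<and> c y < c x" for y
      using less_iff[of y x] that by blast
    then show ?thesis
      unfolding K_def by presburger
  qed
  \<comment> \<open>For \<open>k > 0 > l\<close> the counts \<open>n + k - 2\<close> and
    \<open>n + l\<close> agree only if \<open>k = 1\<close> and \<open>l = - 1\<close>.\<close>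
  have dichotomy: "b x = c x \<or> \<bar>b x\<bar> = 1 \<and> c x = - b x" if "x \<in> ?V" for x
    using K[OF b that] K[OF c that] K_eq[OF that]
      signed_permutation_range[OF b, of x] signed_permutation_range[OF c, of x] that
    by (auto split: if_splits)
  have bc: "b x = c x" if x: "x \<in> {1..int n}" for x
  proof (rule ccontr)
    assume ne: "b x \<noteq> c x"
    have bx: "\<bar>b x\<bar> = 1" "c x = - b x"
      using dichotomy[of x] ne x by auto
    have same: "b y = c y" if "y \<in> {1..int n}" "y \<noteq> x" for y
    proof (rule ccontr)
      assume "b y \<noteq> c y"
      then have "\<bar>b y\<bar> = \<bar>b x\<bar>"
        using dichotomy[of y] that bx by auto
      then have "b y = b x \<or> b y = b (- x)"
        using signed_permutation_uminus[OF b, of x] by (auto simp: abs_eq_iff)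
      then show False
        using that x signed_permutation_inj[OF b] by auto
    qed
    \<comment> \<open>Away from \<open>x\<close> both functions agree, so \<open>A\<close> collects
      their common negative indices. Exactly one of them has \<open>x\<close> as a further negative
      index, so the two parities differ.\<close>
    define A where "A = {i \<in> {1..int n}. i \<noteq> x \<and> b i < 0}"
    have A: "finite A" "x \<notin> A"
      by (rule finite_subset[of _ "{1..int n}"]) (auto simp: A_def)
    have "{i \<in> {1..int n}. b i < 0} = (if b x < 0 then insert x A else A)"
      using x by (auto simp: A_def)
    moreover have "c i < 0 \<longleftrightarrow> (if i = x then \<not> b x < 0 else b i < 0)" if "i \<in> {1..int n}" for i
      using same[OF that] bx by auto
    then have "{i \<in> {1..int n}. c i < 0} = (if b x < 0 then A else insert x A)"
      using x by (auto simp: A_def split: if_splits)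
    ultimately show False
      using par A by (auto split: if_splits)
  qed
  have "b = c"
  proof
    fix x
    consider "x \<in> {1..int n}" | "- x \<in> {1..int n}" | "x \<notin> ?V"
      by force
    then show "b x = c x"
    proof cases
      case 2
      then show ?thesis
        using bc[of "- x"] signed_permutation_uminus[OF b] signed_permutation_uminus[OF c] by simp
    next
      case 3
      then show ?thesis
        using b c permutes_not_in unfolding signed_permutation_def by metis
    qed (rule bc)
  qed
  then have "inv (inv u) = inv (inv v)"
    by (simp add: b_def c_def)
  then show "u = v"
    by (simp only: signed_permutation_inv_inv[OF su] signed_permutation_inv_inv[OF sv])
qed

section \<open>Orders and graphs on the positive half\<close>

text \<open>The order \<open>L\<close> lives on the roots with a name \<open>0 < x < y\<close>,
  which belong to the set when \<open>y\<close> precedes \<open>x\<close>. The names with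
  \<open>x < y < 0\<close> are translated back to these, and the graph \<open>E\<close> lives on the
  roots with \<open>x < 0 < y\<close>.\<close>

definition rel_roots :: "nat \<Rightarrow> (nat \<Rightarrow> nat \<Rightarrow> bool) \<Rightarrow> (nat \<Rightarrow> nat \<Rightarrow> bool) \<Rightarrow> (int \<times> int) set"
  where "rel_roots n L E = {(x, y) \<in> pos_roots n.
    if 0 < x then L (nat y) (nat x)
    else if y < 0 then L (nat (- x)) (nat (- y))
    else E (nat (- x)) (nat y)}"

lemma rel_roots_cong:
  assumes "\<And>i j. i \<in> {1..n} \<Longrightarrow> j \<in> {1..n} \<Longrightarrow> i \<noteq> j \<Longrightarrow> L i j \<longleftrightarrow> L' i j"
    and "\<And>i j. i \<in> {1..n} \<Longrightarrow> j \<in> {1..n} \<Longrightarrow> i \<noteq> j \<Longrightarrow> E i j \<longleftrightarrow> E' i j"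
  shows "rel_roots n L E = rel_roots n L' E'"
proof -
  have "(x, y) \<in> rel_roots n L E \<longleftrightarrow> (x, y) \<in> rel_roots n L' E'" for x y
  proof (cases "(x, y) \<in> pos_roots n")
    case True
    then have xy: "x < y" "x \<noteq> - y" "x \<noteq> 0" "y \<noteq> 0" "\<bar>x\<bar> \<le> int n" "\<bar>y\<bar> \<le> int n"
      by (auto simp: pos_roots_def)
    have nat: "nat z \<in> {1..n}" if "0 < z" "\<bar>z\<bar> \<le> int n" for z
      using that by (simp add: Suc_le_eq nat_le_iff)
    consider "0 < x" "0 < y" | "x < 0" "y < 0" | "x < 0" "0 < y"
      using xy by linarith
    then show ?thesis
    proof cases
      case 1
      have "L (nat y) (nat x) \<longleftrightarrow> L' (nat y) (nat x)"
        by (rule assms(1)) (use nat[of x] nat[of y] xy 1 in auto)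
      then show ?thesis
        using 1 True by (simp add: rel_roots_def)
    next
      case 2
      have "L (nat (- x)) (nat (- y)) \<longleftrightarrow> L' (nat (- x)) (nat (- y))"
        by (rule assms(1)) (use nat[of "- x"] nat[of "- y"] xy 2 in auto)
      then show ?thesis
        using 2 True by (simp add: rel_roots_def)
    next
      case 3
      have "E (nat (- x)) (nat y) \<longleftrightarrow> E' (nat (- x)) (nat y)"
        by (rule assms(2)) (use nat[of "- x"] nat[of y] xy 3 in auto)
      then show ?thesis
        using 3 True by (simp add: rel_roots_def)
    qed
  qed (simp add: rel_roots_def)
  then show ?thesis by auto
qed

text \<open>By oddness, \<open>inv u j < inv u (- i)\<close> means
  \<open>inv u i + inv u j < 0\<close>, so the mixed roots record a graph with threshold 0.\<close>

lemma D_roots_eq_rel_roots: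
  assumes "signed_permutation n u"
  shows "D_roots n u =
    rel_roots n (\<lambda>i j. inv u (int i) < inv u (int j)) (\<lambda>i j. inv u (int i) + inv u (int j) < 0)"
proof -
  note um = signed_permutation_uminus[OF signed_permutation_inv[OF assms]]
  have "(x, y) \<in> D_roots n u \<longleftrightarrow> (x, y) \<in>
    rel_roots n (\<lambda>i j. inv u (int i) < inv u (int j)) (\<lambda>i j. inv u (int i) + inv u (int j) < 0)" for x y
  proof (cases "(x, y) \<in> pos_roots n")
    case True
    then have "x < y" "x \<noteq> 0" "y \<noteq> 0"
      by (auto simp: pos_roots_def)
    then show ?thesis
      using um[of x] um[of y] True unfolding rel_roots_def D_roots_def by auto
  qed (simp add: rel_roots_def D_roots_def)
  then show ?thesis by auto
qed

lemma signed_permutation_of_valuation: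
  fixes a :: "nat \<Rightarrow> int"
  assumes "bij_betw (\<lambda>i. \<bar>a i\<bar>) {1..n} {1..int n}"
  obtains b where "signed_permutation n b" and "\<And>i. i \<in> {1..n} \<Longrightarrow> b (int i) = a i"
proof -
  let ?V = "{- int n..int n} - {0}"
  \<comment> \<open>This is the odd extension of \<open>a\<close>, set to the identity off the
    domain as \<open>permutes\<close> requires. Injectivity holds since
    \<open>\<bar>b x\<bar>\<close> determines \<open>\<bar>x\<bar>\<close>, and
    \<open>b y = b (- y)\<close> would force the value 0.\<close>
  define b where "b x = (if x \<in> ?V then sgn x * a (nat \<bar>x\<bar>) else x)" for x
  have nat: "nat \<bar>x\<bar> \<in> {1..n}" if "x \<in> ?V" for x
    using that by auto
  have range: "\<bar>a i\<bar> \<in> {1..int n}" if "i \<in> {1..n}" for i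
    using bij_betwE[OF assms] that by blast
  have abs_b: "\<bar>b x\<bar> = \<bar>a (nat \<bar>x\<bar>)\<bar>" if "x \<in> ?V" for x
    using that by (simp add: b_def abs_mult abs_sgn_eq)
  have um: "b (- x) = - b x" for x
    by (auto simp: b_def)
  have "b x \<in> ?V" if "x \<in> ?V" for x
  proof -
    have "1 \<le> \<bar>b x\<bar>" "\<bar>b x\<bar> \<le> int n"
      using range[OF nat[OF that]] by (simp_all add: abs_b[OF that])
    then show ?thesis
      by auto
  qed
  then have "b ` ?V \<subseteq> ?V"
    by (rule image_subsetI)
  moreover have inj: "inj_on b ?V"
  proof (rule inj_onI)
    fix x y assume x: "x \<in> ?V" and y: "y \<in> ?V" and eq: "b x = b y"
    then have "\<bar>a (nat \<bar>x\<bar>)\<bar> = \<bar>a (nat \<bar>y\<bar>)\<bar>"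
      using abs_b by metis
    then have "nat \<bar>x\<bar> = nat \<bar>y\<bar>"
      by (rule inj_onD[OF bij_betw_imp_inj_on[OF assms] _ nat[OF x] nat[OF y]])
    then consider "x = y" | "x = - y"
      by linarith
    then show "x = y"
    proof cases
      case 2
      then have "b y = 0"
        using um[of y] eq by simp
      then show ?thesis
        using abs_b[OF y] range[OF nat[OF y]] by simp
    qed
  qed
  ultimately have "bij_betw b ?V ?V"
    by (intro bij_betw_imageI endo_inj_surj) auto
  then have "b permutes ?V"
    by (rule bij_imp_permutes) (auto simp: b_def)
  then have "signed_permutation n b"
    using um by (simp add: signed_permutation_def)
  moreover have "b (int i) = a i" if "i \<in> {1..n}" for i
    using that by (simp add: b_def)
  ultimately show ?thesis
    by (rule that)
qed

section \<open>Biclosed sets as inversion sets\<close>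

text \<open>The valuation realizing \<open>L\<close> and \<open>E\<close> serves as the position
  function, so the permutation is the inverse of its odd extension. The lemma is applied both to
  biclosed sets and to threshold graphs.\<close>

lemma even_signed_permutation_of_relations:
  fixes L E :: "nat \<Rightarrow> nat \<Rightarrow> bool"
  assumes "n \<ge> 1"
    and irr: "\<And>x. x \<in> {1..n} \<Longrightarrow> \<not> L x x"
    and tr: "\<And>x y z. x \<in> {1..n} \<Longrightarrow> y \<in> {1..n} \<Longrightarrow> z \<in> {1..n} \<Longrightarrow> L x y \<Longrightarrow> L y z \<Longrightarrow> L x z"
    and tot: "\<And>x y. x \<in> {1..n} \<Longrightarrow> y \<in> {1..n} \<Longrightarrow> x \<noteq> y \<Longrightarrow> L x y \<or> L y x"
    and "\<And>x y. x \<in> {1..n} \<Longrightarrow> y \<in> {1..n} \<Longrightarrow> E x y \<Longrightarrow> E y x"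
    and "\<And>x y z. x \<in> {1..n} \<Longrightarrow> y \<in> {1..n} \<Longrightarrow> z \<in> {1..n} \<Longrightarrow>
      L x y \<Longrightarrow> E y z \<Longrightarrow> z \<noteq> x \<Longrightarrow> z \<noteq> y \<Longrightarrow> E x z"
  shows "\<exists>u\<in>even_signed_permutations n. D_roots n u = rel_roots n L E"
proof -
  have "{1..n} \<noteq> {}"
    using assms(1) by simp
  have ex: "\<exists>a :: nat \<Rightarrow> int. bij_betw (\<lambda>x. \<bar>a x\<bar>) {1..n} {1..int (card {1..n})} \<and>
      (\<forall>x\<in>{1..n}. \<forall>y\<in>{1..n}. L x y \<longrightarrow> a x < a y) \<and>
      (\<forall>x\<in>{1..n}. \<forall>y\<in>{1..n}. x \<noteq> y \<longrightarrow> (E x y \<longleftrightarrow> a x + a y < 0)) \<and>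
      (even (card {x \<in> {1..n}. a x < 0}) \<longleftrightarrow> True)"
    by (rule realizing_valuation) (fact finite_atLeastAtMost \<open>{1..n} \<noteq> {}\<close> assms(2-6))+
  obtain a :: "nat \<Rightarrow> int" where a: "bij_betw (\<lambda>x. \<bar>a x\<bar>) {1..n} {1..int n}"
      "\<forall>x\<in>{1..n}. \<forall>y\<in>{1..n}. L x y \<longrightarrow> a x < a y"
      "\<forall>x\<in>{1..n}. \<forall>y\<in>{1..n}. x \<noteq> y \<longrightarrow> (E x y \<longleftrightarrow> a x + a y < 0)"
      "even (card {x \<in> {1..n}. a x < 0})"
    using ex by (elim exE conjE) (simp only: card_atLeastAtMost diff_Suc_1 simp_thms)
  obtain b where b: "signed_permutation n b" "\<And>i. i \<in> {1..n} \<Longrightarrow> b (int i) = a i"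
    using signed_permutation_of_valuation[OF a(1)] by blast
  have "{i \<in> {1..int n}. b i < 0} = int ` {x \<in> {1..n}. a x < 0}"
  proof (intro equalityI subsetI)
    fix i assume "i \<in> {i \<in> {1..int n}. b i < 0}"
    moreover from this obtain k where k: "i = int k"
      by (metis (no_types, lifting) atLeastAtMost_iff mem_Collect_eq nonneg_int_cases order_trans zero_le_one)
    ultimately show "i \<in> int ` {x \<in> {1..n}. a x < 0}"
      using b(2)[of k] by auto
  qed (use b(2) in auto)
  then have "card {i \<in> {1..int n}. b i < 0} = card {x \<in> {1..n}. a x < 0}"
    by (simp add: card_image)
  then have "inv b \<in> even_signed_permutations n"
    unfolding even_signed_inv_iff[OF b(1)] using a(4) b(1)
    by (simp only: even_signed_permutations_def mem_Collect_eq)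
  moreover have "D_roots n (inv b) = rel_roots n L E"
    unfolding D_roots_eq_rel_roots[OF signed_permutation_inv[OF b(1)]] signed_permutation_inv_inv[OF b(1)]
  proof (rule rel_roots_cong)
    fix i j assume ij: "i \<in> {1..n}" "j \<in> {1..n}" "i \<noteq> j"
    have "L i j \<longleftrightarrow> a i < a j"
      using a(2) ij tot[of i j] by (metis less_asym)
    then show "b (int i) < b (int j) \<longleftrightarrow> L i j"
      using b(2) ij by simp
    show "b (int i) + b (int j) < 0 \<longleftrightarrow> E i j"
      using a(3) b(2) ij by simp
  qed
  ultimately show ?thesis
    by blast
qed

text \<open>An order \<open>L\<close> and a graph \<open>E\<close> are read off \<open>R\<close>;
  biclosedness provides exactly the transitivity and compatibility that a realizing valuation
  requires.\<close>

lemma D_roots_surj_biclosed: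
  assumes "n \<ge> 1" and R: "biclosed n R"
  shows "\<exists>u\<in>even_signed_permutations n. D_roots n u = R"
proof -
  define L where "L i j \<longleftrightarrow> i < j \<and> (int i, int j) \<notin> R \<or> j < i \<and> (int j, int i) \<in> R" for i j
  define E where "E i j \<longleftrightarrow> (- int i, int j) \<in> R" for i j
  note um = biclosed_uminus[OF R] and tr = biclosed_trans[OF R] and split = biclosed_split[OF R]
  have pos: "(int i, int j) \<in> pos_roots n" if "i \<in> {1..n}" "j \<in> {1..n}" "i < j" for i j
    using that by (auto simp: pos_roots_def)
  have pos': "(- int i, int j) \<in> pos_roots n" if "i \<in> {1..n}" "j \<in> {1..n}" "i \<noteq> j" for i j
    using that by (auto simp: pos_roots_def)
  have "\<exists>u\<in>even_signed_permutations n. D_roots n u = rel_roots n L E"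
  proof (rule even_signed_permutation_of_relations[OF assms(1)])
    fix i j assume "i \<in> {1..n}" "j \<in> {1..n}" "E i j"
    then show "E j i"
      using um[of "- int i" "int j"] by (simp add: E_def)
  next
    fix i j k assume V: "i \<in> {1..n}" "j \<in> {1..n}" "k \<in> {1..n}" and ij: "L i j" and jk: "L j k"
    have "i \<noteq> k"
      using ij jk by (auto simp: L_def)
    have tr': "(int a, int c) \<in> R" if "(int a, int b) \<in> R" "(int b, int c) \<in> R" "a \<in> {1..n}" for a b c
      using tr[OF that(1,2)] that(3) by auto
    have split': "(int a, int b) \<in> R \<or> (int b, int c) \<in> R"
      if "(int a, int c) \<in> R" "a < b" "b < c" "a \<in> {1..n}" "b \<in> {1..n}" "c \<in> {1..n}" for a b c
      using split[OF that(1) pos pos] that by blast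
    \<comment> \<open>If \<open>j\<close> lies numerically between \<open>i\<close> and
      \<open>k\<close>, the root of \<open>i\<close> and \<open>k\<close> is the sum of the other
      two; otherwise it is a summand of one of them. Closedness or splitting then decides.\<close>
    show "L i k"
    proof (cases i k rule: linorder_cases)
      case less
      have "(int i, int k) \<notin> R"
      proof
        assume ik: "(int i, int k) \<in> R"
        consider "i < j" "j < k" | "j < i" | "k < j"
          using ij jk by (auto simp: L_def)
        then show False
        proof cases
          case 1
          then show ?thesis using ij jk split'[OF ik] V by (auto simp: L_def)
        next
          case 2
          then show ?thesis using ij jk less tr'[of j i k] ik V by (auto simp: L_def)
        next
          case 3
          then show ?thesis using ij jk less tr'[of i k j] ik V by (auto simp: L_def)
        qed
      qed
      then show ?thesis using less by (simp add: L_def)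
    next
      case greater
      have "(int k, int i) \<in> R"
      proof -
        consider "k < j" "j < i" | "i < j" | "j < k"
          using ij jk by (auto simp: L_def)
        then show ?thesis
        proof cases
          case 1
          then show ?thesis using ij jk tr'[of k j i] V by (auto simp: L_def)
        next
          case 2
          then show ?thesis using ij jk greater split'[of k j i] V by (auto simp: L_def)
        next
          case 3
          then show ?thesis using ij jk greater split'[of j i k] V by (auto simp: L_def)
        qed
      qed
      then show ?thesis using greater by (simp add: L_def)
    qed (use \<open>i \<noteq> k\<close> in simp)
  next
    fix i j k assume V: "i \<in> {1..n}" "j \<in> {1..n}" "k \<in> {1..n}" and ij: "L i j" and jk: "E j k"
      and ne: "k \<noteq> i" "k \<noteq> j"
    \<comment> \<open>If \<open>i < j\<close>, the root \<open>(- j, k)\<close> splits at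
      \<open>- i\<close> and the summand \<open>(- j, - i)\<close> is not in \<open>R\<close>. If
      \<open>j < i\<close>, then \<open>(- i, - j)\<close> is in \<open>R\<close> and is added to
      \<open>(- j, k)\<close>.\<close>
    from ij consider "i < j" "(int i, int j) \<notin> R" | "j < i" "(int j, int i) \<in> R"
      by (auto simp: L_def)
    then show "E i k"
    proof cases
      case 1
      have "(- int j, - int i) \<notin> R"
        using um[of "- int j" "- int i"] 1 by auto
      moreover have "(- int j, - int i) \<in> pos_roots n"
        using pos_roots_uminus[OF pos[OF V(1,2) 1(1)]] .
      ultimately show ?thesis
        using split[of "- int j" "int k" "- int i"] jk pos'[of i k] V ne by (auto simp: E_def)
    next
      case 2
      then show ?thesis
        using tr[of "- int i" "- int j" "int k"] um[of "int j" "int i"] jk ne by (auto simp: E_def)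
    qed
  qed (auto simp: L_def)
  moreover have "rel_roots n L E = R"
  proof -
    have "(x, y) \<in> rel_roots n L E \<longleftrightarrow> (x, y) \<in> R" for x y
    proof (cases "(x, y) \<in> pos_roots n")
      case True
      then have "x < y" "x \<noteq> 0" "y \<noteq> 0"
        by (auto simp: pos_roots_def)
      moreover have "(x, y) \<in> R \<longleftrightarrow> (- y, - x) \<in> R"
        using um[of x y] um[of "- y" "- x"] by auto
      ultimately show ?thesis
        using True unfolding rel_roots_def L_def E_def by auto
    qed (use biclosed_subset[OF R] in \<open>auto simp: rel_roots_def\<close>)
    then show ?thesis by auto
  qed
  ultimately show ?thesis
    by simp
qed

lemma bij_betw_D_roots:
  assumes "n \<ge> 1"
  shows "bij_betw (D_roots n) (even_signed_permutations n) {R. biclosed n R}"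
proof (rule bij_betw_imageI[OF inj_on_D_roots])
  have "biclosed n (D_roots n u)" if "u \<in> even_signed_permutations n" for u
    using that biclosed_D_roots by (simp add: even_signed_permutations_def)
  then show "D_roots n ` even_signed_permutations n = {R. biclosed n R}"
    using D_roots_surj_biclosed[OF assms] by blast
qed

section \<open>Threshold graphs\<close>

text \<open>Six pairs decide the isomorphism sending \<open>p, q, r, s\<close> to 1, 2, 3, 4; loops
  agree because neither \<open>E\<close> nor \<open>F\<close> contains singletons. A general
  \<open>F\<close> covers all three forbidden graphs.\<close>

lemma has_induced_on_four:
  assumes "simple_graph (V, E)" and "distinct [p, q, r, s]" and "{p, q, r, s} \<subseteq> V"
    and "\<And>k. {k} \<notin> F"
    and "{p, q} \<in> E \<longleftrightarrow> {1, 2} \<in> F" and "{p, r} \<in> E \<longleftrightarrow> {1, 3} \<in> F" and "{p, s} \<in> E \<longleftrightarrow> {1, 4} \<in> F"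
    and "{q, r} \<in> E \<longleftrightarrow> {2, 3} \<in> F" and "{q, s} \<in> E \<longleftrightarrow> {2, 4} \<in> F" and "{r, s} \<in> E \<longleftrightarrow> {3, 4} \<in> F"
  shows "has_induced (V, E) ({1, 2, 3, 4 :: nat}, F)"
proof -
  let ?W = "{p, q, r, s}"
  define f :: "'a \<Rightarrow> nat" where "f = (\<lambda>_. 0)(p := 1, q := 2, r := 3, s := 4)"
  have f: "f p = 1" "f q = 2" "f r = 3" "f s = 4"
    using assms(2) by (auto simp: f_def)
  have "bij_betw f ?W {1, 2, 3, 4}"
    using f by (auto simp: bij_betw_def inj_on_def)
  moreover have loop: "{x} \<notin> E" for x
    using assms(1) by (force simp: simple_graph_def edges_def)
  have "{x, y} \<in> E \<longleftrightarrow> {f x, f y} \<in> F" if "x \<in> ?W" "y \<in> ?W" for x y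
    using that assms(4-) loop f by (elim insertE emptyE) (simp_all add: insert_commute)
  ultimately have "graph_isomorphic (induced (V, E) ?W) ({1, 2, 3, 4}, F)"
    unfolding graph_isomorphic_def induced_def verts_def edges_def
    by (intro exI[of _ f]) simp
  then show ?thesis
    using assms(3) unfolding has_induced_def verts_def by (intro exI[of _ ?W]) simp
qed

text \<open>
  In each of \<open>2K\<^sub>2\<close>, the path and the 4-cycle, \<open>{1, 2}\<close> and \<open>{3, 4}\<close> are edges while
  \<open>{1, 3}\<close> and \<open>{2, 4}\<close> are not; conversely, these three are the only such graphs on four
  vertices.
\<close>

lemma threshold_no_alternating:
  assumes thr: "threshold_graph (V, E)"
    and xt: "{x, t} \<in> E" and yz: "{y, z} \<in> E" and xz: "{x, z} \<notin> E" and yt: "{y, t} \<notin> E"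
    and ne: "x \<noteq> z" "y \<noteq> t"
  shows False
proof -
  have sg: "simple_graph (V, E)"
    using thr by (simp add: threshold_graph_def)
  have edge: "a \<noteq> b \<and> a \<in> V \<and> b \<in> V" if "{a, b} \<in> E" for a b
    using sg that by (force simp: simple_graph_def edges_def verts_def)
  have dist: "distinct [x, t, z, y]"
    using edge[OF xt] edge[OF yz] ne xt yz xz yt by auto
  have sub: "{x, t, z, y} \<subseteq> V"
    using edge[OF xt] edge[OF yz] by auto
  \<comment> \<open>Only these two pairs are undetermined. If neither is an edge, the graph is
    \<open>two_K2\<close>; if one is, it is the middle edge of a path; if both are, the graph is a
    4-cycle.\<close>
  consider "{x, y} \<notin> E" "{t, z} \<notin> E" | "{x, y} \<notin> E" "{t, z} \<in> E"
    | "{x, y} \<in> E" "{t, z} \<notin> E" | "{x, y} \<in> E" "{t, z} \<in> E"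
    by blast
  then show False
  proof cases
    case 1
    have "has_induced (V, E) two_K2"
      unfolding two_K2_def
      by (rule has_induced_on_four[OF sg, of x t z y])
        (use dist sub 1 xt yz xz yt in \<open>simp_all add: doubleton_eq_iff insert_commute\<close>)
    then show ?thesis using thr by (simp add: threshold_graph_def)
  next
    case 2
    have "has_induced (V, E) path_4"
      unfolding path_4_def
      by (rule has_induced_on_four[OF sg, of x t z y])
        (use dist sub 2 xt yz xz yt in \<open>simp_all add: doubleton_eq_iff insert_commute\<close>)
    then show ?thesis using thr by (simp add: threshold_graph_def)
  next
    case 3
    have "has_induced (V, E) path_4"
      unfolding path_4_def
      by (rule has_induced_on_four[OF sg, of t x y z])
        (use dist sub 3 xt yz xz yt in \<open>auto simp: doubleton_eq_iff insert_commute\<close>)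
    then show ?thesis using thr by (simp add: threshold_graph_def)
  next
    case 4
    have "has_induced (V, E) cycle_4"
      unfolding cycle_4_def
      by (rule has_induced_on_four[OF sg, of x t z y])
        (use dist sub 4 xt yz xz yt in \<open>simp_all add: doubleton_eq_iff insert_commute\<close>)
    then show ?thesis using thr by (simp add: threshold_graph_def)
  qed
qed

lemma has_induced_alternating:
  assumes "has_induced (V, E) ({1, 2, 3, 4 :: nat}, F)"
    and "{1, 2} \<in> F" and "{3, 4} \<in> F" and "{1, 3} \<notin> F" and "{2, 4} \<notin> F"
  shows "\<exists>p q r s. {p, q} \<in> E \<and> {r, s} \<in> E \<and> {p, r} \<notin> E \<and> {q, s} \<notin> E \<and> p \<noteq> r \<and> q \<noteq> s"
proof -
  obtain W f where W: "W \<subseteq> V" and bij: "bij_betw f W {1, 2, 3, 4 :: nat}"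
    and iso: "\<And>x y. x \<in> W \<Longrightarrow> y \<in> W \<Longrightarrow> {x, y} \<in> E \<longleftrightarrow> {f x, f y} \<in> F"
    using assms(1) unfolding has_induced_def graph_isomorphic_def induced_def verts_def edges_def by auto
  have pre: "\<exists>p\<in>W. f p = k" if "k \<in> {1, 2, 3, 4}" for k
  proof -
    have "k \<in> f ` W"
      using bij that by (simp add: bij_betw_def)
    then show ?thesis
      by blast
  qed
  obtain p q r s where "p \<in> W" "q \<in> W" "r \<in> W" "s \<in> W" and f: "f p = 1" "f q = 2" "f r = 3" "f s = 4"
    using pre[of 1] pre[of 2] pre[of 3] pre[of 4] by auto
  then have "{p, q} \<in> E" "{r, s} \<in> E" "{p, r} \<notin> E" "{q, s} \<notin> E"
    using iso assms(2-) by simp_all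
  moreover have "p \<noteq> r" "q \<noteq> s"
    using f by auto
  ultimately show ?thesis by blast
qed

text \<open>Converse to \<open>threshold_no_alternating\<close>: an isomorphism pulls the
  alternating pattern back from any of the three forbidden graphs.\<close>

lemma threshold_graphI:
  assumes "simple_graph (V, E)"
    and "\<And>p q r s. {p, q} \<in> E \<Longrightarrow> {r, s} \<in> E \<Longrightarrow> {p, r} \<notin> E \<Longrightarrow> {q, s} \<notin> E \<Longrightarrow>
      p \<noteq> r \<Longrightarrow> q \<noteq> s \<Longrightarrow> False"
  shows "threshold_graph (V, E)"
proof -
  have "\<not> has_induced (V, E) ({1, 2, 3, 4 :: nat}, F)"
    if "{1, 2} \<in> F" "{3, 4} \<in> F" "{1, 3} \<notin> F" "{2, 4} \<notin> F" for F
    using has_induced_alternating[OF _ that] assms(2) by blast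
  then show ?thesis
    using assms(1) unfolding threshold_graph_def two_K2_def path_4_def cycle_4_def
    by (simp add: doubleton_eq_iff)
qed

section \<open>Neighbourhoods and degrees\<close>

lemma simple_graph_edge:
  assumes "simple_graph (V, E)" and "{x, y} \<in> E"
  shows "x \<noteq> y" and "x \<in> V" and "y \<in> V"
  using assms by (force simp: simple_graph_def edges_def verts_def)+

lemma deg_eq_card_neighbours:
  assumes "simple_graph (V, E)"
  shows "deg E v = card {z. {v, z} \<in> E}"
proof -
  have "bij_betw (\<lambda>z. {v, z}) {z. {v, z} \<in> E} {e \<in> E. v \<in> e}"
  proof (rule bij_betw_imageI)
    show "inj_on (\<lambda>z. {v, z}) {z. {v, z} \<in> E}"
      by (auto simp: inj_on_def doubleton_eq_iff)
    have "\<exists>z. e = {v, z}" if "e \<in> E" "v \<in> e" for e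
    proof -
      have "card e = 2"
        using assms that(1) by (simp add: simple_graph_def edges_def)
      then show ?thesis
        using that(2) by (auto simp: card_2_iff)
    qed
    then show "(\<lambda>z. {v, z}) ` {z. {v, z} \<in> E} = {e \<in> E. v \<in> e}"
      by blast
  qed
  then show ?thesis
    by (simp add: deg_def bij_betw_same_card)
qed

lemma finite_neighbours:
  assumes "simple_graph (V, E)"
  shows "finite {z. {v, z} \<in> E}"
proof (rule finite_subset)
  show "{z. {v, z} \<in> E} \<subseteq> V"
    using simple_graph_edge[OF assms] by auto
  show "finite V"
    using assms by (simp add: simple_graph_def verts_def)
qed

text \<open>Meant for the neighbourhoods of two vertices: since adjacency is symmetric, deleting
  each vertex from the neighbourhood of the other removes equally many elements, so degrees may be
  compared without the pair itself.\<close>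

lemma card_delete_mutual:
  fixes A B :: "'a set"
  assumes "finite A" and "finite B" and "y \<in> A \<longleftrightarrow> x \<in> B"
  shows "card (B - {x}) \<le> card (A - {y}) \<longleftrightarrow> card B \<le> card A"
    and "card (B - {x}) < card (A - {y}) \<longleftrightarrow> card B < card A"
proof -
  have "card C = card (C - {c}) + (if c \<in> C then 1 else 0)" if "finite C" for C :: "'a set" and c
    using that card_Suc_Diff1[of C c] by auto
  from this[OF assms(1), of y] this[OF assms(2), of x]
  show "card (B - {x}) \<le> card (A - {y}) \<longleftrightarrow> card B \<le> card A"
    and "card (B - {x}) < card (A - {y}) \<longleftrightarrow> card B < card A"
    using assms(3) by auto
qed

lemma deg_mono:
  assumes sg: "simple_graph (V, E)" and sub: "\<And>z. {y, z} \<in> E \<Longrightarrow> z \<noteq> x \<Longrightarrow> {x, z} \<in> E"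
  shows "deg E y \<le> deg E x"
proof -
  have "{z. {y, z} \<in> E} - {x} \<subseteq> {z. {x, z} \<in> E} - {y}"
    using sub simple_graph_edge(1)[OF sg] by auto
  then have "card ({z. {y, z} \<in> E} - {x}) \<le> card ({z. {x, z} \<in> E} - {y})"
    using finite_neighbours[OF sg] by (intro card_mono) auto
  then show ?thesis
    unfolding deg_eq_card_neighbours[OF sg]
    using card_delete_mutual(1)[OF finite_neighbours[OF sg] finite_neighbours[OF sg], of y x x y]
    by (simp add: insert_commute)
qed

text \<open>Were \<open>z\<close> a neighbour of \<open>y\<close> but not of \<open>x\<close>, the
  absence of alternating patterns would make every neighbour of \<open>x\<close> other than
  \<open>y\<close> a neighbour of \<open>y\<close>. The latter would then have strictly larger
  degree.\<close>

lemma threshold_degree_adjacent: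
  assumes thr: "threshold_graph (V, E)" and deg: "deg E y \<le> deg E x"
    and yz: "{y, z} \<in> E" and "z \<noteq> x"
  shows "{x, z} \<in> E"
proof (rule ccontr)
  assume xz: "{x, z} \<notin> E"
  have sg: "simple_graph (V, E)"
    using thr by (simp add: threshold_graph_def)
  let ?A = "{t. {x, t} \<in> E} - {y}" and ?B = "{t. {y, t} \<in> E} - {x}"
  have "?A \<subseteq> ?B"
  proof
    fix t assume t: "t \<in> ?A"
    then have "{y, t} \<in> E"
      using threshold_no_alternating[OF thr, of x t y z] yz xz \<open>z \<noteq> x\<close> by auto
    then show "t \<in> ?B"
      using t simple_graph_edge(1)[OF sg] by auto
  qed
  moreover have "z \<in> ?B" "z \<notin> ?A"
    using yz xz \<open>z \<noteq> x\<close> by auto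
  ultimately have "?A \<subset> ?B"
    by blast
  then have "card ?A < card ?B"
    using finite_neighbours[OF sg] by (intro psubset_card_mono) auto
  then have "card {t. {x, t} \<in> E} < card {t. {y, t} \<in> E}"
    using card_delete_mutual(2)[OF finite_neighbours[OF sg] finite_neighbours[OF sg], of x y y x]
    by (simp add: insert_commute)
  then show False
    using deg by (simp add: deg_eq_card_neighbours[OF sg])
qed

section \<open>Threshold graphs with degree orderings as biclosed sets\<close>

definition TG_roots :: "nat \<Rightarrow> (nat \<Rightarrow> nat) \<times> nat set set \<Rightarrow> (int \<times> int) set"
  where "TG_roots n = (\<lambda>(w, E). rel_roots n (\<lambda>i j. inv w i < inv w j) (\<lambda>i j. {i, j} \<in> E))"

lemma TG_roots_Inv:
  "i \<in> {1..n} \<Longrightarrow> j \<in> {1..n} \<Longrightarrow> i < j \<Longrightarrow> (int i, int j) \<in> TG_roots n (w, E) \<longleftrightarrow> (i, j) \<in> Inv n w"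
  by (simp add: TG_roots_def rel_roots_def pos_roots_def Inv_def)

lemma TG_roots_edge:
  "i \<in> {1..n} \<Longrightarrow> j \<in> {1..n} \<Longrightarrow> i \<noteq> j \<Longrightarrow> (- int i, int j) \<in> TG_roots n (w, E) \<longleftrightarrow> {i, j} \<in> E"
  by (simp add: TG_roots_def rel_roots_def pos_roots_def)

lemma TG_D:
  assumes "(w, E) \<in> TG n"
  shows "threshold_graph ({1..n}, E)" and "simple_graph ({1..n}, E)" and "w permutes {1..n}"
    and "antimono_on {1..n} (\<lambda>i. deg E (w i))"
  using assms by (auto simp: TG_def degree_ordering_def threshold_graph_def)

text \<open>Roots between letters of the same sign record the inversions of \<open>w\<close>, mixed
  roots the edges, so inclusion compares both components at once.\<close>

lemma TG_roots_subset_iff: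
  assumes "simple_graph ({1..n}, E)"
  shows "TG_roots n (w, E) \<subseteq> TG_roots n (w', E') \<longleftrightarrow> weak_le n w w' \<and> E \<subseteq> E'"
proof (intro iffI conjI)
  assume sub: "TG_roots n (w, E) \<subseteq> TG_roots n (w', E')"
  have "(i, j) \<in> Inv n w'" if ij: "(i, j) \<in> Inv n w" for i j
  proof -
    have "i \<in> {1..n}" "j \<in> {1..n}" "i < j"
      using ij by (auto simp: Inv_def)
    note * = TG_roots_Inv[OF this]
    show ?thesis
      using sub ij *[of w E] *[of w' E'] by blast
  qed
  then show "weak_le n w w'"
    by (auto simp: weak_le_def)
  show "E \<subseteq> E'"
  proof
    fix e assume e: "e \<in> E"
    then have "card e = 2"
      using assms by (simp add: simple_graph_def edges_def)
    then obtain i j where ij: "e = {i, j}"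
      by (auto simp: card_2_iff)
    note * = TG_roots_edge[OF simple_graph_edge(2)[OF assms] simple_graph_edge(3)[OF assms] simple_graph_edge(1)[OF assms]]
    have "{i, j} \<in> E"
      using e ij by simp
    note ** = *[OF this this this]
    show "e \<in> E'"
      using sub e ij **[of w E] **[of w' E'] by blast
  qed
next
  assume le: "weak_le n w w' \<and> E \<subseteq> E'"
  have inv: "inv w' (nat j) < inv w' (nat i)"
    if "inv w (nat j) < inv w (nat i)" "0 < i" "i < j" "j \<le> int n" for i j
  proof -
    have "(nat i, nat j) \<in> Inv n w"
      using that by (simp add: Inv_def Suc_le_eq nat_le_iff)
    then have "(nat i, nat j) \<in> Inv n w'"
      using le by (auto simp: weak_le_def)
    then show ?thesis
      by (simp add: Inv_def)
  qed
  have "(x, y) \<in> TG_roots n (w', E')" if xy: "(x, y) \<in> TG_roots n (w, E)" for x y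
  proof -
    have pos: "(x, y) \<in> pos_roots n"
      using xy by (simp add: TG_roots_def rel_roots_def)
    then have "x < y" "\<bar>x\<bar> \<le> int n" "\<bar>y\<bar> \<le> int n" "x \<noteq> 0" "y \<noteq> 0"
      by (auto simp: pos_roots_def)
    then show ?thesis
      using xy pos inv[where i = x and j = y] inv[where i = "- y" and j = "- x"] le
      by (auto simp: TG_roots_def rel_roots_def split: if_splits)
  qed
  then show "TG_roots n (w, E) \<subseteq> TG_roots n (w', E')"
    by auto
qed

lemma inv_eq_card:
  assumes "w permutes {1..n::nat}" and "i \<in> {1..n}"
  shows "inv w i = Suc (card {j \<in> {1..n}. inv w j < inv w i})"
proof -
  have i: "inv w i \<in> {1..n}"
    using permutes_in_image[OF permutes_inv[OF assms(1)]] assms(2) by blast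
  have "inv w ` {j \<in> {1..n}. inv w j < inv w i} = {1..<inv w i}"
  proof (intro equalityI subsetI)
    fix k assume k: "k \<in> {1..<inv w i}"
    then have "w k \<in> {1..n}"
      using i permutes_in_image[OF assms(1), of k] by auto
    then show "k \<in> inv w ` {j \<in> {1..n}. inv w j < inv w i}"
      using k by (intro image_eqI[of _ _ "w k"]) (auto simp: permutes_inverses[OF assms(1)])
  next
    fix k assume "k \<in> inv w ` {j \<in> {1..n}. inv w j < inv w i}"
    then obtain j where "k = inv w j" "j \<in> {1..n}" "inv w j < inv w i"
      by blast
    then show "k \<in> {1..<inv w i}"
      using permutes_in_image[OF permutes_inv[OF assms(1)], of j] by auto
  qed
  moreover have "card (inv w ` {j \<in> {1..n}. inv w j < inv w i}) = card {j \<in> {1..n}. inv w j < inv w i}"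
    by (rule card_image[OF permutes_inj_on[OF permutes_inv[OF assms(1)]]])
  ultimately have "card {j \<in> {1..n}. inv w j < inv w i} = inv w i - 1"
    by simp
  moreover have "0 < inv w i"
    using i by simp
  ultimately show ?thesis
    by linarith
qed

text \<open>Inversions determine all comparisons between positions, and the position of a letter is
  found by counting those before it.\<close>

lemma permutation_eqI_Inv:
  assumes w: "w permutes {1..n}" and w': "w' permutes {1..n}" and eq: "Inv n w = Inv n w'"
  shows "w = w'"
proof -
  have *: "inv w j < inv w i \<longleftrightarrow> inv w' j < inv w' i" if "i \<in> {1..n}" "j \<in> {1..n}" "i < j" for i j
    using eq that by (auto simp: Inv_def set_eq_iff)
  have inj: "inv v i \<noteq> inv v j" if "v permutes {1..n}" "i \<noteq> j" for v i j
    using that permutes_inj[OF permutes_inv[OF that(1)]] by (simp add: inj_eq)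
  have less_iff: "inv w i < inv w j \<longleftrightarrow> inv w' i < inv w' j" if "i \<in> {1..n}" "j \<in> {1..n}" for i j
  proof (cases i j rule: linorder_cases)
    case less
    then show ?thesis
      using *[of i j] that inj[OF w, of i j] inj[OF w', of i j] by linarith
  next
    case greater
    then show ?thesis
      using *[of j i] that by simp
  qed simp
  have "inv w i = inv w' i" for i
  proof (cases "i \<in> {1..n}")
    case True
    have "{j \<in> {1..n}. inv w j < inv w i} = {j \<in> {1..n}. inv w' j < inv w' i}"
      using less_iff[OF _ True] by (intro Collect_cong) blast
    then show ?thesis
      using inv_eq_card[OF w True] inv_eq_card[OF w' True] by (simp only:)
  next
    case False
    then show ?thesis
      using permutes_not_in[OF permutes_inv[OF w]] permutes_not_in[OF permutes_inv[OF w']] by simp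
  qed
  then have "inv (inv w) = inv (inv w')"
    by presburger
  then show ?thesis
    by (simp only: permutes_inv_inv[OF w] permutes_inv_inv[OF w'])
qed

lemma inj_on_TG_roots: "inj_on (TG_roots n) (TG n)"
proof (rule inj_onI)
  fix p q assume "p \<in> TG n" "q \<in> TG n" "TG_roots n p = TG_roots n q"
  moreover obtain w E w' E' where pq: "p = (w, E)" "q = (w', E')"
    by (metis surj_pair)
  ultimately have TG: "(w, E) \<in> TG n" "(w', E') \<in> TG n" and eq: "TG_roots n (w, E) = TG_roots n (w', E')"
    by simp_all
  have "Inv n w = Inv n w'" "E = E'"
    using TG_roots_subset_iff[OF TG_D(2)[OF TG(1)], of w w' E']
      TG_roots_subset_iff[OF TG_D(2)[OF TG(2)], of w' w E] eq
    by (simp_all add: weak_le_def subset_antisym)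
  then show "p = q"
    using permutation_eqI_Inv[OF TG_D(3)[OF TG(1)] TG_D(3)[OF TG(2)]] pq by simp
qed

lemma permutation_sorting:
  fixes b :: "nat \<Rightarrow> int"
  assumes "inj_on b {1..n}"
  obtains w where "w permutes {1..n}"
    and "\<And>i j. i \<in> {1..n} \<Longrightarrow> j \<in> {1..n} \<Longrightarrow> inv w i < inv w j \<longleftrightarrow> b i < b j"
proof -
  \<comment> \<open>The rank of \<open>b i\<close> is to be the position of the letter
    \<open>i\<close>, so the word \<open>w\<close> is the inverse of \<open>r\<close>.\<close>
  define r where "r i = (if i \<in> {1..n} then card {j \<in> {1..n}. b j \<le> b i} else i)" for i
  have less: "r i < r j" if "i \<in> {1..n}" "j \<in> {1..n}" "b i < b j" for i j
  proof -
    have "{k \<in> {1..n}. b k \<le> b i} \<subseteq> {k \<in> {1..n}. b k \<le> b j}"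
      using that by auto
    moreover have "j \<in> {k \<in> {1..n}. b k \<le> b j}" "j \<notin> {k \<in> {1..n}. b k \<le> b i}"
      using that by auto
    ultimately have "{k \<in> {1..n}. b k \<le> b i} \<subset> {k \<in> {1..n}. b k \<le> b j}"
      by blast
    then have "card {k \<in> {1..n}. b k \<le> b i} < card {k \<in> {1..n}. b k \<le> b j}"
      by (intro psubset_card_mono) simp_all
    then show ?thesis
      using that by (simp add: r_def)
  qed
  have less_iff: "r i < r j \<longleftrightarrow> b i < b j" if "i \<in> {1..n}" "j \<in> {1..n}" for i j
    using less[OF that] less[OF that(2,1)] inj_onD[OF assms _ that] by (cases "b i" "b j" rule: linorder_cases) auto
  have "inj_on r {1..n}"
  proof (rule inj_onI)
    fix i j assume i: "i \<in> {1..n}" and j: "j \<in> {1..n}" and "r i = r j"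
    then have "b i = b j"
      using less_iff[OF i j] less_iff[OF j i] by linarith
    then show "i = j"
      by (rule inj_onD[OF assms _ i j])
  qed
  moreover have "r ` {1..n} \<subseteq> {1..n}"
  proof (rule image_subsetI)
    fix i assume i: "i \<in> {1..n}"
    have "card {i} \<le> card {j \<in> {1..n}. b j \<le> b i}"
      using i by (intro card_mono) auto
    moreover have "card {j \<in> {1..n}. b j \<le> b i} \<le> card {1..n}"
      by (intro card_mono) auto
    ultimately show "r i \<in> {1..n}"
      using i by (simp add: r_def)
  qed
  ultimately have "bij_betw r {1..n} {1..n}"
    by (intro bij_betw_imageI endo_inj_surj) auto
  then have r: "r permutes {1..n}"
    by (rule bij_imp_permutes) (auto simp: r_def)
  show ?thesis
    using that[OF permutes_inv[OF r]] less_iff unfolding permutes_inv_inv[OF r] by blast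
qed

text \<open>A letter placed earlier has at least the degree of a later one, and in a threshold graph
  it therefore inherits the neighbours of the later one. This is the compatibility needed for a
  valuation.\<close>

lemma TG_roots_eq_D_roots:
  assumes "n \<ge> 1" and TG: "(w, E) \<in> TG n"
  shows "\<exists>u\<in>even_signed_permutations n. D_roots n u = TG_roots n (w, E)"
  unfolding TG_roots_def split
proof (rule even_signed_permutation_of_relations[OF assms(1)])
  note w = TG_D(3)[OF TG]
  show "inv w i < inv w j \<or> inv w j < inv w i" if "i \<noteq> j" for i j
    using that permutes_inj[OF permutes_inv[OF w]] by (meson injD linorder_neqE_nat)
  show "{i, k} \<in> E"
    if "i \<in> {1..n}" "j \<in> {1..n}" "inv w i < inv w j" "{j, k} \<in> E" "k \<noteq> i" for i j k
  proof (rule threshold_degree_adjacent[OF TG_D(1)[OF TG] _ that(4,5)])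
    have "inv w i \<in> {1..n}" "inv w j \<in> {1..n}"
      using that(1,2) permutes_in_image[OF permutes_inv[OF w]] by blast+
    from monotone_onD[OF TG_D(4)[OF TG] this]
    have "deg E (w (inv w j)) \<le> deg E (w (inv w i))"
      using that(3) by simp
    then show "deg E j \<le> deg E i"
      by (simp add: permutes_inverses[OF w])
  qed
qed (auto simp: insert_commute)

text \<open>Sorting the letters by their positions \<open>b i\<close> gives \<open>w\<close>, and
  the edges are the pairs with negative sum, a threshold graph with weights
  \<open>- b i\<close>.\<close>

lemma D_roots_eq_TG_roots:
  assumes u: "u \<in> even_signed_permutations n"
  shows "\<exists>p\<in>TG n. TG_roots n p = D_roots n u"
proof -
  have su: "signed_permutation n u"
    using u by (simp add: even_signed_permutations_def)
  define b where "b i = inv u (int i)" for i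
  have "inj b"
    using signed_permutation_inj[OF signed_permutation_inv[OF su]] by (simp add: inj_def b_def)
  then obtain w where w: "w permutes {1..n}"
    and less_iff: "\<And>i j. i \<in> {1..n} \<Longrightarrow> j \<in> {1..n} \<Longrightarrow> inv w i < inv w j \<longleftrightarrow> b i < b j"
    using permutation_sorting inj_on_subset by (metis subset_UNIV)
  define E where "E = {{i, j} | i j. i \<in> {1..n} \<and> j \<in> {1..n} \<and> i \<noteq> j \<and> b i + b j < 0}"
  have E_iff: "{i, j} \<in> E \<longleftrightarrow> i \<in> {1..n} \<and> j \<in> {1..n} \<and> i \<noteq> j \<and> b i + b j < 0" for i j
    by (auto simp: E_def doubleton_eq_iff)
  have sg: "simple_graph ({1..n}, E)"
    by (auto simp: simple_graph_def verts_def edges_def E_def)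
  have "threshold_graph ({1..n}, E)"
  proof (rule threshold_graphI[OF sg])
    fix p q r s
    assume "{p, q} \<in> E" "{r, s} \<in> E" "{p, r} \<notin> E" "{q, s} \<notin> E" "p \<noteq> r" "q \<noteq> s"
    \<comment> \<open>The two edges make \<open>b p + b q + b r + b s\<close> negative, the two
      non-edges make it nonnegative.\<close>
    then show False
      by (simp add: E_iff)
  qed
  moreover have "antimono_on {1..n} (\<lambda>i. deg E (w i))"
  proof (rule monotone_onI)
    fix i j assume ij: "i \<in> {1..n}" "j \<in> {1..n}" "i \<le> j"
    have V: "w i \<in> {1..n}" "w j \<in> {1..n}"
      using ij permutes_in_image[OF w] by blast+
    have "b (w i) \<le> b (w j)"
      using less_iff[OF V(2,1)] ij(3) by (simp add: permutes_inverses[OF w])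
    \<comment> \<open>A smaller value of \<open>b\<close> keeps negative sums negative, so the
      earlier letter has all neighbours of the later one, apart from itself.\<close>
    then show "deg E (w j) \<le> deg E (w i)"
      using V by (intro deg_mono[OF sg]) (auto simp: E_iff)
  qed
  ultimately have "(w, E) \<in> TG n"
    using w by (simp add: TG_def degree_ordering_def)
  moreover have "TG_roots n (w, E) = D_roots n u"
    unfolding TG_roots_def split D_roots_eq_rel_roots[OF su]
    by (rule rel_roots_cong) (simp_all add: less_iff E_iff b_def)
  ultimately show ?thesis
    by blast
qed

lemma bij_betw_TG_roots:
  assumes "n \<ge> 1"
  shows "bij_betw (TG_roots n) (TG n) {R. biclosed n R}"
proof (rule bij_betw_imageI[OF inj_on_TG_roots])
  have "D_roots n ` even_signed_permutations n = {R. biclosed n R}"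
    using bij_betw_D_roots[OF assms] by (simp add: bij_betw_def)
  moreover have "TG_roots n ` TG n = D_roots n ` even_signed_permutations n"
    using TG_roots_eq_D_roots[OF assms] D_roots_eq_TG_roots by (fastforce simp: image_iff)
  ultimately show "TG_roots n ` TG n = {R. biclosed n R}"
    by simp
qed

section \<open>The lattice property and the isomorphism\<close>

theorem mainTheorem5:
  fixes n :: nat
  assumes "n \<ge> 1"
  shows "lattice (TG_poset n) \<and> poset_isomorphic (TG_poset n) (D_poset n)"
proof
  let ?T = "TG_poset n" and ?D = "D_poset n"
  have carrier: "carrier ?T = TG n" "carrier ?D = even_signed_permutations n"
    and eq: "eq ?T = (=)" "eq ?D = (=)"
    by (simp_all add: TG_poset_def D_poset_def)
  have T: "bij_betw (TG_roots n) (carrier ?T) {R. biclosed n R}"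
    and D: "bij_betw (D_roots n) (carrier ?D) {R. biclosed n R}"
    using bij_betw_TG_roots[OF assms] bij_betw_D_roots[OF assms] by (simp_all add: carrier)
  have le_T: "p \<sqsubseteq>\<^bsub>?T\<^esub> q \<longleftrightarrow> TG_roots n p \<subseteq> TG_roots n q" if "p \<in> carrier ?T" "q \<in> carrier ?T" for p q
  proof -
    obtain w E w' E' where pq: "p = (w, E)" "q = (w', E')"
      by (metis surj_pair)
    then show ?thesis
      using that TG_roots_subset_iff[OF TG_D(2), of w E] by (simp add: TG_poset_def)
  qed
  have le_D: "u \<sqsubseteq>\<^bsub>?D\<^esub> v \<longleftrightarrow> D_roots n u \<subseteq> D_roots n v" if "u \<in> carrier ?D" "v \<in> carrier ?D" for u v
    using that Inv_D_subset_iff by (simp add: D_poset_def even_signed_permutations_def)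
  show "lattice ?T"
    by (rule lattice_by_inclusion[OF eq(1) le_T T]) (use biclosed_join biclosed_meet in simp_all)
  \<comment> \<open>Both root maps are order isomorphisms onto the biclosed sets; \<open>f\<close>
    follows one and returns along the other.\<close>
  define f where "f = the_inv_into (carrier ?D) (D_roots n) \<circ> TG_roots n"
  have f: "bij_betw f (carrier ?T) (carrier ?D)"
    unfolding f_def by (rule bij_betw_trans[OF T bij_betw_the_inv_into[OF D]])
  have roots_f: "D_roots n (f p) = TG_roots n p" if "p \<in> carrier ?T" for p
    using f_the_inv_into_f_bij_betw[OF D] bij_betwE[OF T] that by (simp add: f_def)
  have "p \<sqsubseteq>\<^bsub>?T\<^esub> q \<longleftrightarrow> f p \<sqsubseteq>\<^bsub>?D\<^esub> f q" if "p \<in> carrier ?T" "q \<in> carrier ?T" for p q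
    using le_T[OF that] le_D[OF bij_betwE[OF f, rule_format, OF that(1)] bij_betwE[OF f, rule_format, OF that(2)]]
      roots_f that by simp
  then show "poset_isomorphic ?T ?D"
    unfolding poset_isomorphic_def
    using partial_order_by_inclusion[OF eq(1) le_T bij_betw_imp_inj_on[OF T]]
      partial_order_by_inclusion[OF eq(2) le_D bij_betw_imp_inj_on[OF D]] f by blast
qed

end
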